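(* For every simplicial set $F$, the space $L(F)$ is paracompact and perfectly normal. It is also compactly generated.
   Context: $(\Omega,\lambda)$ is a fixed atomless complete probability space. $[n]=\{0,\dots,n\}$; $\mathbf{\Delta}$ is the category of the $[n]$, $n\ge0$, with weakly increasing maps. A simplicial set is a functor $F:\mathbf{\Delta}^{op}\to\mathbf{Set}$, $F_n=F([n])$, $\alpha\sigma=F(\sigma)(\alpha)$. $\nabla_n=L^1(\Omega,[n])$ is the set of measurable maps $f:\Omega\to[n]$ modulo almost everywhere equality, with metric $d(f,g)=\lambda(\{t:f(t)\ne g(t)\})$; $\nabla(\sigma)(f)=\sigma\circ f$. $L(F)$ is the quotient space of $\bigsqcup_nF_n\times\nabla_n$ ($F_n$ discrete) by the equivalence relation generated by $(\alpha\sigma,a)\sim(\alpha,\nabla(\sigma)(a))$ for $\sigma$ in $\mathbf{\Delta}$. Conventions: paracompact spaces are Hausdorff by definition; a space $X$ is perfectly normal if every closed subset is the zero locus of some continuous map $X\to[0,\infty)$. *)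

theory Defs
  imports "HOL-Analysis.Analysis" "HOL-Probability.Probability_Measure"
begin

section \<open>Topological notions\<close>

definition paracompact_space :: "'a topology \<Rightarrow> bool" where
  "paracompact_space X \<longleftrightarrow>
     Hausdorff_space X \<and>
     (\<forall>\<U>. (\<forall>U\<in>\<U>. openin X U) \<and> \<Union>\<U> = topspace X \<longrightarrow>
        (\<exists>\<V>. (\<forall>V\<in>\<V>. openin X V) \<and> \<Union>\<V> = topspace X \<and>
              (\<forall>V\<in>\<V>. \<exists>U\<in>\<U>. V \<subseteq> U) \<and> locally_finite_in X \<V>))"

definition perfectly_normal_space :: "'a topology \<Rightarrow> bool" where
  "perfectly_normal_space X \<longleftrightarrow>
     (\<forall>C. closedin X C \<longrightarrow>
        (\<exists>f. continuous_map X (top_of_set {0::real..}) f \<and> C = {x \<in> topspace X. f x = 0}))"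

definition quotient_topology :: "'a topology \<Rightarrow> 'a rel \<Rightarrow> 'a set topology" where
  "quotient_topology X R = topology (\<lambda>U. U \<subseteq> topspace X // R \<and> openin X (\<Union>U))"

lemma openin_quotient_topology:
  assumes R: "equiv (topspace X) R"
  shows "openin (quotient_topology X R) U \<longleftrightarrow> U \<subseteq> topspace X // R \<and> openin X (\<Union>U)"
proof -
  have int: "\<Union>(S \<inter> T) = \<Union>S \<inter> \<Union>T"
    if "S \<subseteq> topspace X // R" "T \<subseteq> topspace X // R" for S T
  proof -
    have "x \<in> \<Union>(S \<inter> T)" if A: "A \<in> S" "x \<in> A" and B: "B \<in> T" "x \<in> B" for x A B
    proof -
      have "A = B"
        using quotient_disj[OF R, of A B] A B \<open>S \<subseteq> _\<close> \<open>T \<subseteq> _\<close> by blast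
      with A B show ?thesis by blast
    qed
    then show ?thesis by blast
  qed
  have "istopology (\<lambda>U. U \<subseteq> topspace X // R \<and> openin X (\<Union>U))"
    unfolding istopology_def
  proof (intro conjI allI impI)
    fix S T
    assume "S \<subseteq> topspace X // R \<and> openin X (\<Union>S)" "T \<subseteq> topspace X // R \<and> openin X (\<Union>T)"
    then show "S \<inter> T \<subseteq> topspace X // R" "openin X (\<Union>(S \<inter> T))"
      by (auto simp: int)
  next
    fix K
    assume K: "\<forall>S\<in>K. S \<subseteq> topspace X // R \<and> openin X (\<Union>S)"
    then show "\<Union>K \<subseteq> topspace X // R" by blast
    have "\<Union>(\<Union>K) = (\<Union>S\<in>K. \<Union>S)" by blast
    with K show "openin X (\<Union>(\<Union>K))" by auto
  qed
  then show ?thesis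
    by (simp add: quotient_topology_def)
qed

lemma topspace_quotient_topology:
  assumes R: "equiv (topspace X) R"
  shows "topspace (quotient_topology X R) = topspace X // R"
proof (rule antisym)
  show "topspace (quotient_topology X R) \<subseteq> topspace X // R"
    using openin_quotient_topology[OF R] openin_topspace by blast
  have "openin (quotient_topology X R) (topspace X // R)"
    by (simp add: openin_quotient_topology[OF R] Union_quotient[OF R])
  then show "topspace X // R \<subseteq> topspace (quotient_topology X R)"
    by (rule openin_subset)
qed

lemma quotient_map_quotient_topology:
  assumes R: "equiv (topspace X) R"
  shows "quotient_map X (quotient_topology X R) (\<lambda>x. R `` {x})"
proof -
  have "{x \<in> topspace X. R `` {x} \<in> U} = \<Union>U" if U: "U \<subseteq> topspace X // R" for U
  proof (intro set_eqI iffI)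
    fix x assume "x \<in> {x \<in> topspace X. R `` {x} \<in> U}"
    then show "x \<in> \<Union>U" using equiv_class_self[OF R] by blast
  next
    fix x assume "x \<in> \<Union>U"
    then obtain A where A: "A \<in> U" "x \<in> A" by blast
    then obtain y where y: "y \<in> topspace X" "A = R `` {y}"
      using U by (meson quotientE subsetD)
    then have "R `` {x} = A" "x \<in> topspace X"
      using A equiv_class_eq[OF R, of y x] equiv_type[OF R] by auto
    with A show "x \<in> {x \<in> topspace X. R `` {x} \<in> U}" by simp
  qed
  then show ?thesis
    by (auto simp: quotient_map_def topspace_quotient_topology[OF R]
        openin_quotient_topology[OF R] quotient_def)
qed


section \<open>Simplicial sets\<close>

text \<open>The object \<open>[n]\<close> is \<open>{..n}\<close>. Morphisms are extensional, so that equality of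
  morphisms is equality of functions; source and target are kept as separate indices.\<close>

definition Delta :: "nat \<Rightarrow> nat \<Rightarrow> (nat \<Rightarrow> nat) set" where
  "Delta m n = {\<sigma> \<in> {..m} \<rightarrow>\<^sub>E {..n}. mono_on {..m} \<sigma>}"

text \<open>\<open>act m n \<sigma> \<alpha>\<close> is \<open>\<alpha>\<sigma> = F(\<sigma>)(\<alpha>)\<close> for \<open>\<sigma> : [m] \<rightarrow> [n]\<close> and \<open>\<alpha> \<in> F n\<close>.\<close>

locale simplicial_set =
  fixes F :: "nat \<Rightarrow> 'a set"
    and act :: "nat \<Rightarrow> nat \<Rightarrow> (nat \<Rightarrow> nat) \<Rightarrow> 'a \<Rightarrow> 'a"
  assumes act_closed: "\<And>m n \<sigma> \<alpha>. \<lbrakk>\<sigma> \<in> Delta m n; \<alpha> \<in> F n\<rbrakk> \<Longrightarrow> act m n \<sigma> \<alpha> \<in> F m"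
    and act_id: "\<And>n \<alpha>. \<alpha> \<in> F n \<Longrightarrow> act n n (restrict id {..n}) \<alpha> = \<alpha>"
    and act_comp: "\<And>k m n \<sigma> \<tau> \<alpha>. \<lbrakk>\<tau> \<in> Delta k m; \<sigma> \<in> Delta m n; \<alpha> \<in> F n\<rbrakk> \<Longrightarrow>
           act k n (compose {..k} \<sigma> \<tau>) \<alpha> = act k m \<tau> (act m n \<sigma> \<alpha>)"


section \<open>The spaces of measurable maps to \<open>[n]\<close>\<close>

definition atomless :: "'w measure \<Rightarrow> bool" where
  "atomless M \<longleftrightarrow>
     (\<forall>A\<in>sets M. 0 < emeasure M A \<longrightarrow>
        (\<exists>B\<in>sets M. B \<subseteq> A \<and> 0 < emeasure M B \<and> emeasure M B < emeasure M A))"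

definition ae_rel :: "'w measure \<Rightarrow> nat \<Rightarrow> ('w \<Rightarrow> nat) rel" where
  "ae_rel M n = {(f, g). f \<in> measurable M (count_space {..n}) \<and>
     g \<in> measurable M (count_space {..n}) \<and> (AE t in M. f t = g t)}"

definition nabla :: "'w measure \<Rightarrow> nat \<Rightarrow> ('w \<Rightarrow> nat) set set" where
  "nabla M n = measurable M (count_space {..n}) // ae_rel M n"

text \<open>The value does not depend on the representatives; see \<open>nabla_dist_class\<close>.\<close>

definition nabla_dist :: "'w measure \<Rightarrow> ('w \<Rightarrow> nat) set \<Rightarrow> ('w \<Rightarrow> nat) set \<Rightarrow> real" where
  "nabla_dist M a b = measure M {t \<in> space M. (SOME f. f \<in> a) t \<noteq> (SOME g. g \<in> b) t}"

definition nabla_topology :: "'w measure \<Rightarrow> nat \<Rightarrow> ('w \<Rightarrow> nat) set topology" where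
  "nabla_topology M n = Metric_space.mtopology (nabla M n) (nabla_dist M)"

text \<open>For \<open>\<sigma> : [m] \<rightarrow> [n]\<close> this sends the class of \<open>f\<close> to the class of \<open>\<sigma> \<circ> f\<close> in \<open>nabla M n\<close>;
  see \<open>nabla_map_class\<close>.\<close>

definition nabla_map ::
    "'w measure \<Rightarrow> nat \<Rightarrow> (nat \<Rightarrow> nat) \<Rightarrow> ('w \<Rightarrow> nat) set \<Rightarrow> ('w \<Rightarrow> nat) set" where
  "nabla_map M n \<sigma> a = (\<Union>f\<in>a. ae_rel M n `` {\<sigma> \<circ> f})"

lemma equiv_ae_rel: "equiv (measurable M (count_space {..n})) (ae_rel M n)"
proof (rule equivI)
  show "ae_rel M n \<subseteq> measurable M (count_space {..n}) \<times> measurable M (count_space {..n})"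
    by (auto simp: ae_rel_def)
  show "refl_on (measurable M (count_space {..n})) (ae_rel M n)"
    by (auto simp: ae_rel_def refl_on_def)
  show "sym (ae_rel M n)"
    by (auto simp: ae_rel_def sym_def elim: eventually_mono)
  show "trans (ae_rel M n)"
    unfolding trans_def ae_rel_def by (auto elim: eventually_elim2)
qed

lemma sets_neq:
  assumes "f \<in> measurable M (count_space {..n::nat})" "g \<in> measurable M (count_space {..n})"
  shows "{t \<in> space M. f t \<noteq> g t} \<in> sets M"
proof -
  have "{t \<in> space M. f t \<noteq> g t} = (\<Union>k\<in>{..n}. (f -` {k} \<inter> space M) - (g -` {k} \<inter> space M))"
    using measurable_space[OF assms(1)] by auto
  also have "\<dots> \<in> sets M"
    using assms by (intro sets.finite_UN sets.Diff measurable_sets) auto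
  finally show ?thesis .
qed

lemma nabla_some:
  assumes "f \<in> measurable M (count_space {..n})"
  shows "(f, SOME f'. f' \<in> ae_rel M n `` {f}) \<in> ae_rel M n"
proof -
  have "f \<in> ae_rel M n `` {f}"
    using assms equiv_class_self[OF equiv_ae_rel] by fast
  then have "(SOME f'. f' \<in> ae_rel M n `` {f}) \<in> ae_rel M n `` {f}"
    by (rule someI[where P = "\<lambda>f'. f' \<in> ae_rel M n `` {f}"])
  then show ?thesis by simp
qed

lemma nabla_dist_class:
  assumes f: "f \<in> measurable M (count_space {..n})" and g: "g \<in> measurable M (count_space {..n})"
  shows "nabla_dist M (ae_rel M n `` {f}) (ae_rel M n `` {g}) = measure M {t \<in> space M. f t \<noteq> g t}"
  unfolding nabla_dist_def
  by (rule measure_eq_AE)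
    (use nabla_some[OF f] nabla_some[OF g] in
      \<open>auto simp: ae_rel_def intro!: sets_neq[where n = n] elim: eventually_elim2\<close>)

lemma Metric_space_nabla:
  assumes "prob_space M"
  shows "Metric_space (nabla M n) (nabla_dist M)"
proof
  interpret prob_space M by fact
  show "0 \<le> nabla_dist M x y" for x y
    by (simp add: nabla_dist_def)
  show "nabla_dist M x y = nabla_dist M y x" for x y
    by (simp add: nabla_dist_def eq_commute)
  show "nabla_dist M x y = 0 \<longleftrightarrow> x = y" if xy: "x \<in> nabla M n" "y \<in> nabla M n" for x y
  proof -
    obtain f g where fg: "f \<in> measurable M (count_space {..n})" "x = ae_rel M n `` {f}"
        "g \<in> measurable M (count_space {..n})" "y = ae_rel M n `` {g}"
      using xy unfolding nabla_def by (meson quotientE)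
    have "nabla_dist M x y = 0 \<longleftrightarrow> (AE t in M. f t = g t)"
      using sets_neq[OF fg(1,3)]
      by (simp add: fg nabla_dist_class AE_iff_measurable[OF _ refl] emeasure_eq_measure)
    also have "\<dots> \<longleftrightarrow> (f, g) \<in> ae_rel M n"
      using fg by (simp add: ae_rel_def)
    also have "\<dots> \<longleftrightarrow> x = y"
      using fg eq_equiv_class_iff[OF equiv_ae_rel] by blast
    finally show ?thesis .
  qed
  show "nabla_dist M x z \<le> nabla_dist M x y + nabla_dist M y z"
    if xyz: "x \<in> nabla M n" "y \<in> nabla M n" "z \<in> nabla M n" for x y z
  proof -
    obtain f g h where fgh: "f \<in> measurable M (count_space {..n})" "x = ae_rel M n `` {f}"
        "g \<in> measurable M (count_space {..n})" "y = ae_rel M n `` {g}"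
        "h \<in> measurable M (count_space {..n})" "z = ae_rel M n `` {h}"
      using xyz unfolding nabla_def by (meson quotientE)
    let ?A = "{t \<in> space M. f t \<noteq> g t}" and ?B = "{t \<in> space M. g t \<noteq> h t}"
    have s: "?A \<in> sets M" "?B \<in> sets M"
      using fgh sets_neq by blast+
    have "measure M {t \<in> space M. f t \<noteq> h t} \<le> measure M (?A \<union> ?B)"
      using s by (intro finite_measure_mono) auto
    also have "\<dots> \<le> measure M ?A + measure M ?B"
      using s by (rule measure_Un_le)
    finally show ?thesis
      by (simp add: fgh nabla_dist_class)
  qed
qed

lemma measurable_Delta_comp:
  assumes "\<sigma> \<in> Delta m n" "f \<in> measurable M (count_space {..m})"
  shows "\<sigma> \<circ> f \<in> measurable M (count_space {..n})"
  using assms by (intro measurable_comp[OF assms(2)]) (auto simp: Delta_def)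

lemma nabla_map_class:
  assumes \<sigma>: "\<sigma> \<in> Delta m n" and f: "f \<in> measurable M (count_space {..m})"
  shows "nabla_map M n \<sigma> (ae_rel M m `` {f}) = ae_rel M n `` {\<sigma> \<circ> f}"
  unfolding nabla_map_def
proof (rule UN_equiv_class[OF equiv_ae_rel _ f])
  show "(\<lambda>f. ae_rel M n `` {\<sigma> \<circ> f}) respects ae_rel M m"
  proof (rule congruentI)
    fix g h assume gh: "(g, h) \<in> ae_rel M m"
    then have "(\<sigma> \<circ> g, \<sigma> \<circ> h) \<in> ae_rel M n"
      using \<sigma> by (auto simp: ae_rel_def intro!: measurable_Delta_comp elim: eventually_mono)
    then show "ae_rel M n `` {\<sigma> \<circ> g} = ae_rel M n `` {\<sigma> \<circ> h}"
      by (rule equiv_class_eq[OF equiv_ae_rel])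
  qed
qed

lemma nabla_map_closed:
  assumes "\<sigma> \<in> Delta m n" "a \<in> nabla M m"
  shows "nabla_map M n \<sigma> a \<in> nabla M n"
  using assms unfolding nabla_def
  by (metis quotientE quotientI nabla_map_class measurable_Delta_comp)


section \<open>The space \<open>L(F)\<close>\<close>

type_synonym ('w, 'a) pre_point = "nat \<times> 'a \<times> ('w \<Rightarrow> nat) set"

definition L_sum :: "'w measure \<Rightarrow> (nat \<Rightarrow> 'a set) \<Rightarrow> ('w, 'a) pre_point topology" where
  "L_sum M F =
     sum_topology (\<lambda>n. prod_topology (discrete_topology (F n)) (nabla_topology M n)) UNIV"

definition L_gen :: "'w measure \<Rightarrow> (nat \<Rightarrow> 'a set) \<Rightarrow> (nat \<Rightarrow> nat \<Rightarrow> (nat \<Rightarrow> nat) \<Rightarrow> 'a \<Rightarrow> 'a) \<Rightarrow>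
    ('w, 'a) pre_point \<Rightarrow> ('w, 'a) pre_point \<Rightarrow> bool" where
  "L_gen M F act x y \<longleftrightarrow>
     (\<exists>m n \<sigma> \<alpha> a. \<sigma> \<in> Delta m n \<and> \<alpha> \<in> F n \<and> a \<in> nabla M m \<and>
        x = (m, act m n \<sigma> \<alpha>, a) \<and> y = (n, \<alpha>, nabla_map M n \<sigma> a))"

definition L_rel :: "'w measure \<Rightarrow> (nat \<Rightarrow> 'a set) \<Rightarrow> (nat \<Rightarrow> nat \<Rightarrow> (nat \<Rightarrow> nat) \<Rightarrow> 'a \<Rightarrow> 'a) \<Rightarrow>
    ('w, 'a) pre_point rel" where
  "L_rel M F act = {(x, y). x \<in> topspace (L_sum M F) \<and> y \<in> topspace (L_sum M F) \<and>
     equivclp (L_gen M F act) x y}"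

definition L_space :: "'w measure \<Rightarrow> (nat \<Rightarrow> 'a set) \<Rightarrow>
    (nat \<Rightarrow> nat \<Rightarrow> (nat \<Rightarrow> nat) \<Rightarrow> 'a \<Rightarrow> 'a) \<Rightarrow> ('w, 'a) pre_point set topology" where
  "L_space M F act = quotient_topology (L_sum M F) (L_rel M F act)"

lemma topspace_L_sum:
  assumes "prob_space M"
  shows "topspace (L_sum M F) = (SIGMA n:UNIV. F n \<times> nabla M n)"
  using Metric_space.topspace_mtopology[OF Metric_space_nabla[OF assms]]
  by (simp add: L_sum_def nabla_topology_def comp_def)

lemma L_gen_in_topspace:
  assumes "prob_space M" "simplicial_set F act" "L_gen M F act x y"
  shows "x \<in> topspace (L_sum M F)" "y \<in> topspace (L_sum M F)"
  using assms(3) simplicial_set.act_closed[OF assms(2)]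
  by (auto simp: L_gen_def topspace_L_sum[OF assms(1)] intro: nabla_map_closed)

lemma equiv_L_rel: "equiv (topspace (L_sum M F)) (L_rel M F act)"
  by (rule equivI)
    (auto simp: L_rel_def refl_on_def sym_def trans_def
      intro: equivclp_sym equivclp_trans)

lemma quotient_map_L_space:
  "quotient_map (L_sum M F) (L_space M F act) (\<lambda>x. L_rel M F act `` {x})"
  unfolding L_space_def by (rule quotient_map_quotient_topology[OF equiv_L_rel])

end

theory Submission
  imports Defs
begin

text \<open>
  The realization \<open>L(F)\<close> is filtered by the images of the levels \<open>\<le> n\<close>, and step \<open>n\<close> is obtained from
  step \<open>n - 1\<close> by attaching, for every nondegenerate \<open>\<alpha> \<in> F\<^sub>n\<close>, a copy of the metric space \<open>\<nabla>\<^sub>n\<close>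
  along the closed subspace of those classes whose essential image is a proper subset of \<open>[n]\<close>.
  The statement holds for every space with such a filtration (locale \<open>cell_filtration\<close>);
  the particular spaces \<open>\<nabla>\<^sub>n\<close> only matter for showing that \<open>L(F)\<close> is one of them.

  In a \<open>cell_filtration\<close>, functions are constructed one step at a time (\<open>cell_recursion\<close>), so every
  construction on the whole space reduces to an extension problem from the closed set \<open>A n\<close> to the
  metrizable space \<open>Y n\<close>. For perfect normality the problem is to extend a nonnegative function with
  prescribed zero set, which is solved by Tietze's theorem (\<open>extend_zero_function\<close>). Since points
  are closed, the Hausdorff property follows. For paracompactness, \<open>extend_disjoint_open\<close> shows that
  a disjoint family of open sets in one stratum extends to a disjoint family of open sets of
  the whole space. An open cover is treated on each stratum separately: Stone's argument
  (\<open>metrizable_sigma_discrete_refinement\<close>) refines it there by countably many families of closed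
  sets with disjoint open neighbourhoods. Those neighbourhoods extend to the whole space, and by
  perfect normality the extensions shrink to locally finite families. This gives countably many
  locally finite open families, refining the cover and together covering the space, from which
  perfect normality produces one locally finite refinement (\<open>sigma_locally_finite_refinement\<close>).
  Compact generation passes from the \<open>Y n\<close> to the quotient.

  That \<open>L(F)\<close> is such a filtration is the analogue of the cell structure of a geometric
  realization. Every point of \<open>L(F)\<close> has exactly one representative \<open>(\<gamma>, b)\<close> with \<open>\<gamma>\<close>
  nondegenerate and \<open>b\<close> of full essential image: restrict to the essential image,
  and then remove degeneracies by the Eilenberg-Zilber lemma. Uniqueness holds because this normal
  form is invariant under the generating relation (\<open>normal_form_L_gen\<close>).
\<close>

section \<open>Perfectly normal spaces\<close>

lemma perfectly_normal_space_iff: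
  "perfectly_normal_space X \<longleftrightarrow>
     (\<forall>C. closedin X C \<longrightarrow>
       (\<exists>f. continuous_map X euclideanreal f \<and> (\<forall>x\<in>topspace X. 0 \<le> f x \<and> (f x = 0 \<longleftrightarrow> x \<in> C))))"
proof -
  have "(continuous_map X (top_of_set {0..}) f \<and> C = {x \<in> topspace X. f x = 0}) \<longleftrightarrow>
        (continuous_map X euclideanreal f \<and> (\<forall>x\<in>topspace X. 0 \<le> f x \<and> (f x = 0 \<longleftrightarrow> x \<in> C)))"
    if "closedin X C" for C and f :: "'a \<Rightarrow> real"
    using closedin_subset[OF that] by (auto simp: continuous_map_in_subtopology)
  then show ?thesis
    by (simp add: perfectly_normal_space_def cong: imp_cong)
qed

lemma perfectly_normal_spaceE:
  assumes "perfectly_normal_space X" "closedin X C"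
  obtains f where "continuous_map X euclideanreal f"
    "\<And>x. x \<in> topspace X \<Longrightarrow> 0 \<le> f x" "\<And>x. x \<in> topspace X \<Longrightarrow> f x = 0 \<longleftrightarrow> x \<in> C"
  using assms unfolding perfectly_normal_space_iff by metis

lemma openin_less:
  assumes "continuous_map X euclideanreal f" "continuous_map X euclideanreal g"
  shows "openin X {x \<in> topspace X. f x < g x}"
proof -
  have "continuous_map X euclideanreal (\<lambda>x. g x - f x)"
    using assms by (intro continuous_map_diff)
  then have "openin X {x \<in> topspace X. g x - f x \<in> {0<..}}"
    by (rule openin_continuous_map_preimage) auto
  then show ?thesis by simp
qed

lemma perfectly_normal_imp_Hausdorff_space:
  assumes pn: "perfectly_normal_space X" and T1: "\<And>x. x \<in> topspace X \<Longrightarrow> closedin X {x}"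
  shows "Hausdorff_space X"
  unfolding Hausdorff_space_def
proof (intro allI impI)
  fix x y assume xy: "x \<in> topspace X \<and> y \<in> topspace X \<and> x \<noteq> y"
  obtain f where f: "continuous_map X euclideanreal f"
    "\<And>z. z \<in> topspace X \<Longrightarrow> 0 \<le> f z" "\<And>z. z \<in> topspace X \<Longrightarrow> f z = 0 \<longleftrightarrow> z \<in> {x}"
    using perfectly_normal_spaceE[OF pn T1, of x] xy by metis
  define c where "c = f y / 2"
  have c: "f x < c" "c < f y"
    using f(2)[of y] f(3)[of x] f(3)[of y] xy by (auto simp: c_def)
  let ?U = "{z \<in> topspace X. f z < c}" and ?V = "{z \<in> topspace X. c < f z}"
  have "openin X ?U" "openin X ?V"
    using f(1) by (auto intro!: openin_less)
  moreover have "x \<in> ?U" "y \<in> ?V" "disjnt ?U ?V"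
    using xy c by (auto simp: disjnt_def)
  ultimately show "\<exists>U V. openin X U \<and> openin X V \<and> x \<in> U \<and> y \<in> V \<and> disjnt U V"
    by blast
qed

text \<open>In a perfectly normal space it suffices to refine a cover by countably many locally
  finite families of open sets: their unions have a locally finite shrinking, since each is the
  set where some continuous function is positive.\<close>

lemma sigma_locally_finite_refinement:
  fixes \<V> :: "nat \<Rightarrow> 'a set set"
  assumes pn: "perfectly_normal_space X"
    and op: "\<And>j V. V \<in> \<V> j \<Longrightarrow> openin X V"
    and cov: "(\<Union>j. \<Union>(\<V> j)) = topspace X"
    and lf: "\<And>j. locally_finite_in X (\<V> j)"
  shows "\<exists>\<W>. (\<forall>W\<in>\<W>. openin X W \<and> (\<exists>j. \<exists>V\<in>\<V> j. W \<subseteq> V)) \<and> \<Union>\<W> = topspace X \<and> locally_finite_in X \<W>"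
proof -
  have "\<exists>w. continuous_map X euclideanreal w \<and>
      (\<forall>x\<in>topspace X. 0 \<le> w x \<and> (w x = 0 \<longleftrightarrow> x \<notin> \<Union>(\<V> j)))" for j
  proof -
    have "closedin X (topspace X - \<Union>(\<V> j))"
      using op by blast
    then show ?thesis
      by (rule perfectly_normal_spaceE[OF pn]) (metis DiffD2 DiffI)
  qed
  then obtain w where w: "\<And>j. continuous_map X euclideanreal (w j)"
    "\<And>j x. x \<in> topspace X \<Longrightarrow> 0 \<le> w j x" "\<And>j x. x \<in> topspace X \<Longrightarrow> w j x = 0 \<longleftrightarrow> x \<notin> \<Union>(\<V> j)"
    by metis
  \<comment> \<open>A point with \<open>w i x > 0\<close> has a neighbourhood that meets only finitely many \<open>R j\<close>, while the
    first index \<open>j\<close> with \<open>x \<in> \<Union>(\<V> j)\<close> satisfies \<open>x \<in> R j\<close>.\<close>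
  define R where "R j = {x \<in> topspace X. \<forall>i<j. w i x < inverse (real (Suc j))}" for j
  have R: "openin X (R j)" for j
  proof -
    have "R j = (\<Inter>i\<in>{..<j}. {x \<in> topspace X. w i x < inverse (real (Suc j))}) \<inter> topspace X"
      by (auto simp: R_def)
    also have "openin X \<dots>"
      using w(1) by (intro openin_INT) (auto intro!: openin_less)
    finally show ?thesis .
  qed
  define \<W> where "\<W> = (\<Union>j. (\<lambda>V. V \<inter> R j) ` \<V> j)"
  have "\<forall>W\<in>\<W>. openin X W \<and> (\<exists>j. \<exists>V\<in>\<V> j. W \<subseteq> V)"
    using op R by (auto simp: \<W>_def)
  moreover have un: "\<Union>\<W> = topspace X"
  proof
    show "\<Union>\<W> \<subseteq> topspace X"
      by (auto simp: \<W>_def R_def)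
    show "topspace X \<subseteq> \<Union>\<W>"
    proof
      fix x assume x: "x \<in> topspace X"
      define j where "j = (LEAST j. x \<in> \<Union>(\<V> j))"
      have "\<exists>j. x \<in> \<Union>(\<V> j)" using cov x by blast
      then have "x \<in> \<Union>(\<V> j)" "\<And>i. i < j \<Longrightarrow> x \<notin> \<Union>(\<V> i)"
        unfolding j_def by (metis LeastI, metis not_less_Least)
      moreover from this(2) have "w i x = 0" if "i < j" for i
        using w(3)[OF x, of i] that by blast
      then have "x \<in> R j" using x by (auto simp: R_def)
      ultimately show "x \<in> \<Union>\<W>" by (auto simp: \<W>_def)
    qed
  qed
  moreover have "locally_finite_in X \<W>"
    unfolding locally_finite_in_def
  proof (intro conjI ballI)
    show "\<Union>\<W> \<subseteq> topspace X" using un by simp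
    fix x assume x: "x \<in> topspace X"
    then obtain i where i: "x \<in> \<Union>(\<V> i)" using cov by blast
    define c where "c = w i x / 2"
    have "w i x > 0" using w(2)[OF x, of i] w(3)[OF x, of i] i by linarith
    then have c: "c > 0" "c < w i x" by (auto simp: c_def)
    obtain N where N: "inverse (real (Suc N)) < c" using reals_Archimedean[OF c(1)] by blast
    define B where "B = {y \<in> topspace X. c < w i y}"
    have B: "openin X B" "x \<in> B"
      using w(1) c x by (auto simp: B_def intro!: openin_less)
    define m where "m = Suc (max i N)"
    have far: "R j \<inter> B = {}" if "m \<le> j" for j
    proof -
      have "i < j" "N \<le> j" using that by (auto simp: m_def)
      then have "inverse (real (Suc j)) \<le> inverse (real (Suc N))"
        by (intro le_imp_inverse_le) auto
      then have "w i y < c" if "y \<in> R j" for y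
      proof -
        have "w i y < inverse (real (Suc j))"
          using that \<open>i < j\<close> by (auto simp: R_def)
        then show ?thesis
          using N \<open>inverse (real (Suc j)) \<le> inverse (real (Suc N))\<close> by linarith
      qed
      then show ?thesis by (fastforce simp: B_def)
    qed
    have "\<forall>j. \<exists>Q. openin X Q \<and> x \<in> Q \<and> finite {V \<in> \<V> j. V \<inter> Q \<noteq> {}}"
      using lf x unfolding locally_finite_in_def by blast
    from choice[OF this] obtain Q where Q: "\<And>j. openin X (Q j)" "\<And>j. x \<in> Q j"
      "\<And>j. finite {V \<in> \<V> j. V \<inter> Q j \<noteq> {}}"
      by blast
    define P where "P = B \<inter> (\<Inter>j\<in>{..<m}. Q j)"
    have "{W \<in> \<W>. W \<inter> P \<noteq> {}} \<subseteq> (\<Union>j\<in>{..<m}. (\<lambda>V. V \<inter> R j) ` {V \<in> \<V> j. V \<inter> Q j \<noteq> {}})"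
    proof
      fix W assume "W \<in> {W \<in> \<W>. W \<inter> P \<noteq> {}}"
      then obtain j V where jV: "V \<in> \<V> j" "W = V \<inter> R j" "V \<inter> R j \<inter> P \<noteq> {}"
        by (auto simp: \<W>_def)
      have "j < m"
        using far[of j] jV(3) by (cases "j < m") (auto simp: P_def)
      moreover from this have "V \<inter> Q j \<noteq> {}" using jV(3) by (auto simp: P_def)
      ultimately show "W \<in> (\<Union>j\<in>{..<m}. (\<lambda>V. V \<inter> R j) ` {V \<in> \<V> j. V \<inter> Q j \<noteq> {}})"
        using jV by blast
    qed
    moreover have "finite (\<Union>j\<in>{..<m}. (\<lambda>V. V \<inter> R j) ` {V \<in> \<V> j. V \<inter> Q j \<noteq> {}})"
      using Q(3) by blast
    ultimately have "finite {W \<in> \<W>. W \<inter> P \<noteq> {}}" by (rule finite_subset)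
    moreover have "openin X P"
    proof (cases "m = 0")
      case False
      then show ?thesis unfolding P_def using B Q by (intro openin_Int openin_INT2) auto
    qed (simp add: m_def)
    moreover have "x \<in> P" using B Q by (auto simp: P_def)
    ultimately show "\<exists>V. openin X V \<and> x \<in> V \<and> finite {U \<in> \<W>. U \<inter> V \<noteq> {}}" by blast
  qed
  ultimately show ?thesis by blast
qed

text \<open>A closed set covered by a disjoint family of open sets is covered by a locally finite
  shrinking of that family: shrink to a neighbourhood \<open>W\<close> of the closed set whose closure stays
  in the union.\<close>

lemma disjoint_open_shrink_locally_finite:
  assumes pn: "perfectly_normal_space X" and D: "closedin X D"
    and op: "\<And>i. i \<in> I \<Longrightarrow> openin X (G i)"
    and disj: "\<And>i j. \<lbrakk>i \<in> I; j \<in> I; i \<noteq> j\<rbrakk> \<Longrightarrow> G i \<inter> G j = {}" and cov: "D \<subseteq> (\<Union>i\<in>I. G i)"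
  shows "\<exists>\<V>. (\<forall>V\<in>\<V>. openin X V \<and> (\<exists>i\<in>I. V \<subseteq> G i)) \<and> D \<subseteq> \<Union>\<V> \<and> locally_finite_in X \<V>"
proof -
  obtain f where f: "continuous_map X euclideanreal f" "\<And>x. x \<in> topspace X \<Longrightarrow> 0 \<le> f x"
    "\<And>x. x \<in> topspace X \<Longrightarrow> f x = 0 \<longleftrightarrow> x \<in> D"
    using perfectly_normal_spaceE[OF pn D] by blast
  have "closedin X (topspace X - (\<Union>i\<in>I. G i))" using op by blast
  then obtain g where g: "continuous_map X euclideanreal g" "\<And>x. x \<in> topspace X \<Longrightarrow> 0 \<le> g x"
    "\<And>x. x \<in> topspace X \<Longrightarrow> g x = 0 \<longleftrightarrow> x \<notin> (\<Union>i\<in>I. G i)"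
    by (rule perfectly_normal_spaceE[OF pn]) (metis DiffD2 DiffI)
  define W where "W = {x \<in> topspace X. f x < g x}"
  have W: "openin X W" unfolding W_def using f(1) g(1) by (rule openin_less)
  define \<V> where "\<V> = (\<lambda>i. G i \<inter> W) ` I"
  have DW: "D \<subseteq> W"
  proof
    fix x assume "x \<in> D"
    moreover have x: "x \<in> topspace X" using closedin_subset[OF D] \<open>x \<in> D\<close> by blast
    ultimately have "f x = 0" "g x \<noteq> 0" using f(3) g(3) cov by blast+
    then show "x \<in> W" using g(2)[OF x] x by (auto simp: W_def)
  qed
  have "\<exists>V. openin X V \<and> x \<in> V \<and> finite {U \<in> \<V>. U \<inter> V \<noteq> {}}" if x: "x \<in> topspace X" for x
  proof (cases "x \<in> (\<Union>i\<in>I. G i)")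
    case True
    then obtain i where i: "i \<in> I" "x \<in> G i" by blast
    have "{U \<in> \<V>. U \<inter> G i \<noteq> {}} \<subseteq> {G i \<inter> W}"
      using disj i(1) by (auto simp: \<V>_def)
    then have "finite {U \<in> \<V>. U \<inter> G i \<noteq> {}}" by (rule finite_subset) simp
    then show ?thesis using op[OF i(1)] i(2) by blast
  next
    case False
    then have "g x = 0" "f x \<noteq> 0" using f(3) g(3) x cov by blast+
    then have "x \<in> {y \<in> topspace X. g y < f y}" using f(2)[OF x] x by auto
    moreover have "openin X {y \<in> topspace X. g y < f y}" using f(1) g(1) by (intro openin_less)
    moreover have "{U \<in> \<V>. U \<inter> {y \<in> topspace X. g y < f y} \<noteq> {}} = {}"
      by (auto simp: \<V>_def W_def)
    then have "finite {U \<in> \<V>. U \<inter> {y \<in> topspace X. g y < f y} \<noteq> {}}"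
      by (simp only: finite.emptyI)
    ultimately show ?thesis by blast
  qed
  then have "locally_finite_in X \<V>"
    unfolding locally_finite_in_def by (auto simp: \<V>_def W_def)
  moreover have "\<forall>V\<in>\<V>. openin X V \<and> (\<exists>i\<in>I. V \<subseteq> G i)"
    using op W by (auto simp: \<V>_def)
  moreover have "D \<subseteq> \<Union>\<V>" using DW cov by (auto simp: \<V>_def)
  ultimately show ?thesis by blast
qed

section \<open>Extension and refinement in metrizable spaces\<close>

text \<open>The distance to \<open>C\<close> is a continuous function with zero set \<open>C\<close>.\<close>

lemma metrizable_imp_perfectly_normal_space:
  assumes "metrizable_space X"
  shows "perfectly_normal_space X"
  unfolding perfectly_normal_space_iff
proof (intro allI impI)
  fix C assume C: "closedin X C"
  obtain M d where Md: "Metric_space M d" and X: "X = Metric_space.mtopology M d"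
    using assms unfolding metrizable_space_def by blast
  interpret Metric_space M d by fact
  show "\<exists>f. continuous_map X euclideanreal f \<and> (\<forall>x\<in>topspace X. 0 \<le> f x \<and> (f x = 0 \<longleftrightarrow> x \<in> C))"
  proof (cases "C = {}")
    case True
    then show ?thesis
      by (intro exI[of _ "\<lambda>_. 1"]) auto
  next
    case False
    define f where "f x = (INF c\<in>C. d x c)" for x
    have bdd: "bdd_below (d x ` C)" for x
      by (rule bdd_belowI2[of _ 0]) auto
    have CM: "C \<subseteq> M"
      using closedin_subset[OF C] by (simp add: X)
    have f_le: "f x \<le> d x c" if "c \<in> C" for x c
      unfolding f_def by (rule cINF_lower[OF bdd that])
    have f_ge: "r \<le> f x" if "\<And>c. c \<in> C \<Longrightarrow> r \<le> d x c" for x r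
      unfolding f_def using False that by (rule cINF_greatest)
    have lip: "f x \<le> f y + d x y" if "x \<in> M" "y \<in> M" for x y
    proof -
      have "f x - d x y \<le> d y c" if "c \<in> C" for c
        using f_le[OF that, of x] triangle[of x y c] \<open>x \<in> M\<close> \<open>y \<in> M\<close> CM that by auto
      from f_ge[OF this] show ?thesis by simp
    qed
    have cont: "continuous_map X euclideanreal f"
      unfolding X continuous_map_def topspace_mtopology
    proof (intro conjI allI impI)
      fix U assume "openin euclideanreal U"
      then have U: "open U" by simp
      show "openin mtopology {x \<in> M. f x \<in> U}"
        unfolding openin_mtopology
      proof (intro conjI allI impI)
        fix x assume x: "x \<in> {x \<in> M. f x \<in> U}"
        then obtain e where e: "e > 0" "ball (f x) e \<subseteq> U"
          using U by (auto elim: openE)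
        have "f y \<in> U" if "y \<in> mball x e" for y
        proof -
          have "dist (f x) (f y) < e"
            using that lip[of x y] lip[of y x] commute[of x y] by (auto simp: dist_real_def)
          then show ?thesis using e by auto
        qed
        then show "\<exists>r>0. mball x r \<subseteq> {x \<in> M. f x \<in> U}"
          using e(1) by (intro exI[of _ e]) auto
      qed auto
    qed auto
    have "f x = 0 \<longleftrightarrow> x \<in> C" if x: "x \<in> M" for x
    proof
      assume "x \<in> C"
      then have "f x \<le> 0" using f_le[of x x] x by simp
      then show "f x = 0" using f_ge[of 0 x] by simp
    next
      assume f0: "f x = 0"
      show "x \<in> C"
      proof (rule ccontr)
        assume "x \<notin> C"
        then have "x \<in> M - C" using x by simp
        moreover have "openin mtopology (M - C)"
          using C by (auto simp: X closedin_def)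
        ultimately obtain r where r: "r > 0" "mball x r \<subseteq> M - C"
          unfolding openin_mtopology by blast
        have "r \<le> d x c" if "c \<in> C" for c
          using r(2) that x CM by (force simp: in_mball)
        from f_ge[OF this] show False using r(1) f0 by simp
      qed
    qed
    moreover have "0 \<le> f x" for x
      by (rule f_ge) simp
    ultimately show ?thesis
      using cont by (auto simp: X)
  qed
qed

text \<open>A function on \<open>A\<close> with zero set \<open>A \<inter> C\<close> extends to one with zero set \<open>C\<close>.\<close>

lemma extend_zero_function:
  assumes Y: "normal_space Y" "perfectly_normal_space Y"
    and A: "closedin Y A" and C: "closedin Y C"
    and f: "continuous_map (subtopology Y A) euclideanreal f"
    and f0: "\<And>y. y \<in> A \<Longrightarrow> 0 \<le> f y" "\<And>y. y \<in> A \<Longrightarrow> f y = 0 \<longleftrightarrow> y \<in> C"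
  shows "\<exists>g. continuous_map Y euclideanreal g \<and> (\<forall>y\<in>A. g y = f y) \<and>
           (\<forall>y\<in>topspace Y. 0 \<le> g y \<and> (g y = 0 \<longleftrightarrow> y \<in> C))"
proof -
  \<comment> \<open>Paste \<open>f\<close> with the zero function on \<open>C\<close>, extend, and add a function vanishing exactly
    on \<open>A \<union> C\<close>.\<close>
  define h where "h y = (if y \<in> A then f y else 0)" for y
  have AC: "closedin Y (A \<union> C)"
    using A C by blast
  have AY: "A \<subseteq> topspace Y" "C \<subseteq> topspace Y"
    using A C closedin_subset by blast+
  have "continuous_map (subtopology Y (A \<union> C)) euclideanreal h"
    unfolding continuous_map_closedin
  proof (intro conjI ballI allI impI)
    fix T assume T: "closedin euclideanreal T"
    have fz: "f y = 0" if "y \<in> A" "y \<in> C" for y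
      using f0(2) that by blast
    have "closedin (subtopology Y A) {y \<in> topspace (subtopology Y A). f y \<in> T}"
      by (rule closedin_continuous_map_preimage[OF f T])
    then have "closedin Y {y \<in> topspace (subtopology Y A). f y \<in> T}"
      using A closedin_closed_subtopology by blast
    then have 1: "closedin Y ({y \<in> A. f y \<in> T} \<union> (if 0 \<in> T then C else {}))"
      using C AY by (auto simp: Int_absorb1)
    have "{y \<in> topspace (subtopology Y (A \<union> C)). h y \<in> T} =
        {y \<in> A. f y \<in> T} \<union> (if 0 \<in> T then C else {})"
      using AY fz by (auto simp: h_def split: if_splits)
    with 1 show "closedin (subtopology Y (A \<union> C)) {y \<in> topspace (subtopology Y (A \<union> C)). h y \<in> T}"
      using AC by (auto simp: closedin_closed_subtopology)
  qed auto
  moreover have "h ` (A \<union> C) \<subseteq> {0..}"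
    using f0 by (auto simp: h_def)
  ultimately obtain g where g: "continuous_map Y euclideanreal g" "g ` topspace Y \<subseteq> {0..}"
    "\<And>y. y \<in> A \<union> C \<Longrightarrow> g y = h y"
    using Tietze_extension_realinterval[OF Y(1) AC, of "{0..}" h] by (auto simp: is_interval_ci)
  obtain w where w: "continuous_map Y euclideanreal w" "\<And>y. y \<in> topspace Y \<Longrightarrow> 0 \<le> w y"
    "\<And>y. y \<in> topspace Y \<Longrightarrow> w y = 0 \<longleftrightarrow> y \<in> A \<union> C"
    using perfectly_normal_spaceE[OF Y(2) AC] by blast
  have g0: "0 \<le> g y" if "y \<in> topspace Y" for y
    using g(2) that by auto
  show ?thesis
  proof (intro exI[of _ "\<lambda>y. g y + w y"] conjI ballI)
    show "continuous_map Y euclideanreal (\<lambda>y. g y + w y)"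
      using g(1) w(1) by (intro continuous_map_add)
    show eq: "g y + w y = f y" if "y \<in> A" for y
    proof -
      have "w y = 0" using w(3)[of y] AY that by auto
      then show ?thesis using g(3)[of y] that by (simp add: h_def)
    qed
    show "0 \<le> g y + w y" if "y \<in> topspace Y" for y
      using g0[OF that] w(2)[OF that] by simp
    show "g y + w y = 0 \<longleftrightarrow> y \<in> C" if y: "y \<in> topspace Y" for y
    proof (cases "y \<in> A")
      case True
      then show ?thesis using eq f0 by simp
    next
      case False
      then have "h y = 0" by (simp add: h_def)
      then show ?thesis
        using False g0[OF y] w(2,3)[OF y] g(3)[of y] by (cases "y \<in> C") auto
    qed
  qed
qed

text \<open>Disjoint relatively open subsets \<open>G i\<close> of a subspace \<open>A\<close> of a metrizable space extend to
  disjoint open sets: surround each point \<open>u\<close> of \<open>G i\<close> by balls whose radius is at most half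
  the distance from \<open>u\<close> to \<open>A - G i\<close>.\<close>

lemma extend_disjoint_open:
  assumes "metrizable_space Y" and "A \<subseteq> topspace Y"
    and op: "\<forall>i. openin (subtopology Y A) (G i)"
    and dj: "\<forall>i j. i \<noteq> j \<longrightarrow> G i \<inter> G j = {}"
  shows "\<exists>H. (\<forall>i. openin Y (H i) \<and> H i \<inter> A = G i) \<and> (\<forall>i j. i \<noteq> j \<longrightarrow> H i \<inter> H j = {})"
proof -
  have G: "openin (subtopology Y A) (G i)" for i using op by blast
  have disj: "G i \<inter> G j = {}" if "i \<noteq> j" for i j using dj that by blast
  obtain M d where Md: "Metric_space M d" and Y: "Y = Metric_space.mtopology M d"
    using assms(1) unfolding metrizable_space_def by blast
  interpret Metric_space M d by fact
  have AM: "A \<subseteq> M" using assms(2) by (simp add: Y)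
  have GA: "G i \<subseteq> A" for i using openin_subset[OF G[of i]] by auto
  define H where "H i = \<Union>{mball u e |u e. u \<in> G i \<and> 0 < e \<and> (\<forall>a\<in>A - G i. 2 * e \<le> d u a)}" for i
  have "openin Y (H i)" for i
    unfolding H_def Y by (intro openin_Union) auto
  moreover have "H i \<inter> A = G i" for i
  proof
    show "H i \<inter> A \<subseteq> G i"
    proof
      fix y assume "y \<in> H i \<inter> A"
      then obtain u e where "y \<in> A" "y \<in> mball u e" "u \<in> G i" "0 < e" "\<forall>a\<in>A - G i. 2 * e \<le> d u a"
        unfolding H_def by blast
      then have "y \<in> A - G i \<Longrightarrow> 2 * e \<le> d u y" "d u y < e" by (auto simp: in_mball)
      then show "y \<in> G i" using \<open>y \<in> A\<close> \<open>0 < e\<close> by fastforce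
    qed
    show "G i \<subseteq> H i \<inter> A"
    proof
      fix u assume u: "u \<in> G i"
      obtain T where T: "openin Y T" "G i = T \<inter> A"
        using G[of i] by (auto simp: openin_subtopology)
      then obtain r where r: "r > 0" "mball u r \<subseteq> T"
        using u unfolding Y openin_mtopology by blast
      have "2 * (r/2) \<le> d u a" if a: "a \<in> A - G i" for a
        using r(2) T(2) a AM GA u by (force simp: in_mball)
      moreover have "u \<in> mball u (r/2)"
        using r(1) subsetD[OF AM subsetD[OF GA u]] by simp
      ultimately have "u \<in> H i"
        unfolding H_def using u r(1) half_gt_zero by blast
      then show "u \<in> H i \<inter> A" using u GA by blast
    qed
  qed
  moreover have "H i \<inter> H j = {}" if ij: "i \<noteq> j" for i j
  proof (rule ccontr)
    assume "H i \<inter> H j \<noteq> {}"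
    then obtain y where "y \<in> H i" "y \<in> H j" by blast
    obtain u e where u: "y \<in> mball u e" "u \<in> G i" "0 < e" "\<forall>a\<in>A - G i. 2 * e \<le> d u a"
      using \<open>y \<in> H i\<close> unfolding H_def by blast
    obtain v e' where v: "y \<in> mball v e'" "v \<in> G j" "0 < e'" "\<forall>a\<in>A - G j. 2 * e' \<le> d v a"
      using \<open>y \<in> H j\<close> unfolding H_def by blast
    have "u \<in> A - G j" "v \<in> A - G i"
      using u v disj[OF ij] GA by blast+
    then have "2 * e \<le> d u v" "2 * e' \<le> d v u"
      using u v by blast+
    moreover have "d u v < e + e'"
      using u(1) v(1) triangle[of u y v] commute[of v y] by (auto simp: in_mball)
    ultimately show False by (simp add: commute)
  qed
  ultimately show ?thesis by blast
qed

text \<open>Half of Stone's theorem: an open family of a metrizable space has a \<open>\<sigma>\<close>-discrete closed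
  refinement \<open>D\<close>, with disjoint open neighbourhoods \<open>G\<close>.  Well-order the index set; \<open>D k i\<close>
  consists of the points outside all earlier \<open>V j\<close> whose ball of radius \<open>1/(k+1)\<close> lies in
  \<open>V i\<close>, so that for fixed \<open>k\<close> different ones of these sets are at distance at least
  \<open>1/(k+1)\<close>.\<close>

lemma metrizable_sigma_discrete_refinement:
  fixes V :: "'i \<Rightarrow> 'b set"
  assumes "metrizable_space Y" and op: "\<forall>i\<in>I. openin Y (V i)"
  shows "\<exists>D G :: nat \<Rightarrow> 'i \<Rightarrow> 'b set.
    (\<forall>k. \<forall>i\<in>I. D k i \<subseteq> G k i \<and> G k i \<subseteq> V i \<and> openin Y (G k i)) \<and>
    (\<forall>k. \<forall>i\<in>I. \<forall>j\<in>I. i \<noteq> j \<longrightarrow> G k i \<inter> G k j = {}) \<and>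
    (\<forall>k. closedin Y (\<Union>i\<in>I. D k i)) \<and> (\<Union>i\<in>I. V i) = (\<Union>k. \<Union>i\<in>I. D k i)"
proof -
  have V: "openin Y (V i)" if "i \<in> I" for i
    using op that by blast
  obtain M d where Md: "Metric_space M d" and Y: "Y = Metric_space.mtopology M d"
    using assms(1) unfolding metrizable_space_def by blast
  interpret Metric_space M d by fact
  obtain W :: "'i rel" where W: "well_order_on I W"
    using well_order_on by blast
  then have wfW: "wf (W - Id)" and totW: "\<And>i j. \<lbrakk>i \<in> I; j \<in> I; i \<noteq> j\<rbrakk> \<Longrightarrow> (i,j) \<in> W \<or> (j,i) \<in> W"
    and WI: "W \<subseteq> I \<times> I"
    unfolding well_order_on_def linear_order_on_def partial_order_on_def preorder_on_def
      total_on_def refl_on_def by blast+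
  define r where "r k = inverse (real (Suc k))" for k
  have r0: "r k > 0" for k by (simp add: r_def)
  define D where "D k i = {x \<in> M. mball x (r k) \<subseteq> V i \<and> (\<forall>j. (j,i) \<in> W - Id \<longrightarrow> x \<notin> V j)}" for k i
  define G where "G k i = (\<Union>x\<in>D k i. mball x (r k / 2))" for k i
  have sep': "r k \<le> d x y" if "x \<in> D k i" "y \<in> D k j" "(j,i) \<in> W - Id" for k i j x y
  proof (rule ccontr)
    assume "\<not> r k \<le> d x y"
    then have "x \<in> mball y (r k)"
      using that by (auto simp: D_def in_mball commute)
    then have "x \<in> V j" using that(2) by (auto simp: D_def)
    then show False using that(1,3) by (auto simp: D_def)
  qed
  have sep: "r k \<le> d x y" if "x \<in> D k i" "y \<in> D k j" "i \<noteq> j" "i \<in> I" "j \<in> I" for k i j x y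
    using sep'[of x k i y j] sep'[of y k j x i] totW[of i j] that by (auto simp: commute)
  have DM: "D k i \<subseteq> M" for k i by (auto simp: D_def)
  have DG: "D k i \<subseteq> G k i" for k i
    using r0[of k] DM by (force simp: G_def)
  have GV: "G k i \<subseteq> V i" for k i
    using mball_subset_concentric[of "r k / 2" "r k"] r0[of k] by (fastforce simp: G_def D_def)
  have Gop: "openin Y (G k i)" for k i
    unfolding Y G_def by auto
  have Gdisj: "G k i \<inter> G k j = {}" if "i \<in> I" "j \<in> I" "i \<noteq> j" for k i j
  proof (rule ccontr)
    assume "G k i \<inter> G k j \<noteq> {}"
    then obtain x y z where xyz: "x \<in> D k i" "y \<in> D k j" "z \<in> mball x (r k / 2)" "z \<in> mball y (r k / 2)"
      unfolding G_def by blast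
    then have "d x y < r k"
      using triangle[of x z y] commute[of y z] by (auto simp: in_mball)
    then show False using sep[OF xyz(1,2)] that by simp
  qed
  have Dcl: "closedin Y (\<Union>i\<in>I. D k i)" for k
  proof -
    have "\<exists>e>0. mball x e \<subseteq> M - (\<Union>i\<in>I. D k i)" if x: "x \<in> M - (\<Union>i\<in>I. D k i)" for x
    proof (cases "\<exists>i\<in>I. \<exists>y\<in>D k i. d x y < r k / 2")
      case False
      then have "mball x (r k / 2) \<subseteq> M - (\<Union>i\<in>I. D k i)"
        by (auto simp: in_mball)
      then show ?thesis using r0[of k] half_gt_zero by blast
    next
      \<comment> \<open>Within \<open>r k / 2\<close> of \<open>x\<close> only one of the sets \<open>D k i\<close> occurs, and that one is closed.\<close>
      case True
      then obtain i y where i: "i \<in> I" "y \<in> D k i" "d x y < r k / 2" by blast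
      have near: "j = i" if "j \<in> I" "z \<in> D k j" "d x z < r k / 2" for j z
      proof (rule ccontr)
        assume "j \<noteq> i"
        then have "r k \<le> d y z" using sep[OF i(2) that(2)] i that by auto
        moreover have "d y z \<le> d y x + d x z"
          using triangle[of y x z] x i that DM by blast
        ultimately show False using i(3) that(3) by (simp add: commute)
      qed
      have "x \<notin> D k i" using x i by blast
      then consider w where "w \<in> mball x (r k)" "w \<notin> V i" | j where "(j,i) \<in> W - Id" "x \<in> V j"
        using x i(1) unfolding D_def by blast
      then obtain e where e: "e > 0" "mball x e \<inter> D k i = {}"
      proof cases
        case 1
        show ?thesis
        proof (rule that[of "r k - d x w"])
          show "mball x (r k - d x w) \<inter> D k i = {}"
          proof (rule ccontr)
            assume "mball x (r k - d x w) \<inter> D k i \<noteq> {}"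
            then obtain z where z: "d x z < r k - d x w" "z \<in> D k i" by auto
            then have "d z w < r k"
              using triangle[of z x w] x 1 DM by (force simp: commute)
            then have "w \<in> mball z (r k)" using 1 z DM by auto
            then show False using z(2) 1 by (auto simp: D_def)
          qed
        qed (use 1 in auto)
      next
        case 2
        then have "openin Y (V j)" using WI V by blast
        then obtain e where "e > 0" "mball x e \<subseteq> V j"
          using 2 unfolding Y openin_mtopology by blast
        then show ?thesis using that[of e] 2 by (auto simp: D_def)
      qed
      have "mball x (min e (r k / 2)) \<inter> D k j = {}" if "j \<in> I" for j
        using e(2) near[OF that] by (auto simp: in_mball)
      then show ?thesis
        using e(1) r0[of k] by (intro exI[of _ "min e (r k / 2)"]) auto
    qed
    then show ?thesis
      unfolding Y closedin_def openin_mtopology topspace_mtopology using DM by blast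
  qed
  have "(\<Union>i\<in>I. V i) = (\<Union>k. \<Union>i\<in>I. D k i)"
  proof
    show "(\<Union>i\<in>I. V i) \<subseteq> (\<Union>k. \<Union>i\<in>I. D k i)"
    proof
      fix x assume "x \<in> (\<Union>i\<in>I. V i)"
      then obtain i0 where "i0 \<in> {i \<in> I. x \<in> V i}" by blast
      then obtain i where i: "i \<in> I" "x \<in> V i" "\<And>j. (j,i) \<in> W - Id \<Longrightarrow> j \<notin> {i \<in> I. x \<in> V i}"
        using wfE_min[OF wfW] by (metis (lifting) mem_Collect_eq)
      obtain e where e: "e > 0" "mball x e \<subseteq> V i"
        using V[OF i(1)] i(2) unfolding Y openin_mtopology by blast
      obtain k where "r k < e"
        using reals_Archimedean[OF e(1)] by (auto simp: r_def)
      then have "mball x (r k) \<subseteq> V i"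
        using e(2) mball_subset_concentric[of "r k" e] by auto
      moreover have "x \<in> M" using openin_subset[OF V[OF i(1)]] i(2) by (auto simp: Y)
      ultimately have "x \<in> D k i" using i(3) WI by (auto simp: D_def)
      then show "x \<in> (\<Union>k. \<Union>i\<in>I. D k i)" using i(1) by blast
    qed
    show "(\<Union>k. \<Union>i\<in>I. D k i) \<subseteq> (\<Union>i\<in>I. V i)"
    proof (intro UN_least)
      fix k i assume "i \<in> I"
      then show "D k i \<subseteq> (\<Union>i\<in>I. V i)"
        using subset_trans[OF DG[of k i] GV[of k i]] by (rule SUP_upper2)
    qed
  qed
  then show ?thesis
    by (intro exI[of _ D] exI[of _ G] conjI allI ballI impI DG GV Gop Gdisj Dcl)
qed

section \<open>Spaces filtered by metrizable strata\<close>

text \<open>The index of the member of a disjoint family \<open>H\<close> that contains \<open>y\<close>, if there is one.\<close>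

definition family_index :: "('i \<Rightarrow> 'b set) \<Rightarrow> 'b \<Rightarrow> 'i option" where
  "family_index H y = (if \<exists>i. y \<in> H i then Some (THE i. y \<in> H i) else None)"

lemma family_index_eq_Some:
  assumes "\<And>i j. i \<noteq> j \<Longrightarrow> H i \<inter> H j = {}"
  shows "family_index H y = Some i \<longleftrightarrow> y \<in> H i"
proof -
  have "(THE j. y \<in> H j) = i" if "y \<in> H i" for i
    using assms that by (intro the_equality) blast+
  then show ?thesis by (auto simp: family_index_def)
qed

text \<open>
  A space \<open>X\<close> with the weak topology with respect to maps \<open>\<phi> n : Y n \<rightarrow> X\<close> from metrizable spaces. The
  closed set \<open>A n\<close> is mapped into the union of the lower strata, and the strata
  \<open>\<phi> m (Y m - A m)\<close> partition \<open>X\<close> and are parametrized injectively. The assumption \<open>attach\<close> says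
  that the attaching map \<open>A n \<rightarrow> X\<close> is continuous for the weak topology that the maps \<open>\<phi> m\<close>,
  \<open>m < n\<close>, determine. All cells of one dimension are collected in the single space \<open>Y n\<close>.
\<close>

locale cell_filtration =
  fixes X :: "'x topology" and Y :: "nat \<Rightarrow> 'b topology" and A :: "nat \<Rightarrow> 'b set"
    and \<phi> :: "nat \<Rightarrow> 'b \<Rightarrow> 'x"
  assumes metrizable: "metrizable_space (Y n)"
    and closed_A: "closedin (Y n) (A n)"
    and map_in: "y \<in> topspace (Y n) \<Longrightarrow> \<phi> n y \<in> topspace X"
    and boundary: "y \<in> A n \<Longrightarrow> \<exists>m<n. \<exists>z\<in>topspace (Y m) - A m. \<phi> n y = \<phi> m z"
    and unique: "\<lbrakk>y \<in> topspace (Y n) - A n; z \<in> topspace (Y m) - A m; \<phi> n y = \<phi> m z\<rbrakk>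
       \<Longrightarrow> n = m \<and> y = z"
    and cover: "x \<in> topspace X \<Longrightarrow> \<exists>n. \<exists>y\<in>topspace (Y n) - A n. x = \<phi> n y"
    and closedin_iff: "closedin X C \<longleftrightarrow>
       C \<subseteq> topspace X \<and> (\<forall>n. closedin (Y n) {y \<in> topspace (Y n). \<phi> n y \<in> C})"
    and attach: "\<lbrakk>C \<subseteq> topspace X; \<And>m. m < n \<Longrightarrow> closedin (Y m) {y \<in> topspace (Y m). \<phi> m y \<in> C}\<rbrakk>
       \<Longrightarrow> closedin (Y n) {y \<in> A n. \<phi> n y \<in> C}"
begin

text \<open>The stratum of index \<open>n\<close>: the part of \<open>X\<close> that step \<open>n\<close> adds. It need not be open.\<close>

definition cell :: "nat \<Rightarrow> 'x set" where
  "cell n = \<phi> n ` (topspace (Y n) - A n)"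

lemma A_subset: "A n \<subseteq> topspace (Y n)"
  using closed_A closedin_subset by blast

lemma cell_disjoint: "\<lbrakk>x \<in> cell n; x \<in> cell m\<rbrakk> \<Longrightarrow> n = m"
  unfolding cell_def using unique by blast

lemma inj_on_cell: "inj_on (\<phi> n) (topspace (Y n) - A n)"
  using unique by (meson inj_onI)

lemma boundary_cell: "y \<in> A n \<Longrightarrow> \<exists>m<n. \<phi> n y \<in> cell m"
  using boundary unfolding cell_def by blast

lemma map_cell_le: "y \<in> topspace (Y n) \<Longrightarrow> \<exists>m\<le>n. \<phi> n y \<in> cell m"
  using boundary_cell[of y n] by (cases "y \<in> A n") (auto simp: cell_def intro: less_imp_le)

lemma openin_preimage_iff:
  assumes "C \<subseteq> topspace X"
  shows "openin (Y n) {y \<in> topspace (Y n). \<phi> n y \<in> C} \<longleftrightarrow>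
         closedin (Y n) {y \<in> topspace (Y n). \<phi> n y \<in> topspace X - C}"
proof -
  have "{y \<in> topspace (Y n). \<phi> n y \<in> topspace X - C} =
      topspace (Y n) - {y \<in> topspace (Y n). \<phi> n y \<in> C}"
    using map_in by auto
  then show ?thesis
    by (simp add: openin_closedin_eq)
qed

lemma openin_iff:
  "openin X U \<longleftrightarrow> U \<subseteq> topspace X \<and> (\<forall>n. openin (Y n) {y \<in> topspace (Y n). \<phi> n y \<in> U})"
proof (cases "U \<subseteq> topspace X")
  case True
  then show ?thesis
    by (simp add: openin_closedin_eq[of X] closedin_iff openin_preimage_iff)
qed (auto dest: openin_subset)

text \<open>
  Step-by-step construction of a function \<open>h\<close> on \<open>X\<close>: if a function that satisfies \<open>P m\<close> on \<open>Y m\<close> for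
  all \<open>m < n\<close> can be extended from \<open>A n\<close> to a function on \<open>Y n\<close> satisfying \<open>P n\<close>, then some \<open>h\<close>
  satisfies \<open>P n\<close> on all \<open>Y n\<close>. Only the values on \<open>Y n\<close> may matter for \<open>P n\<close>.
\<close>

lemma cell_recursion:
  fixes P :: "nat \<Rightarrow> ('b \<Rightarrow> 'v) \<Rightarrow> bool"
  assumes ext: "\<And>n h. (\<And>m. m < n \<Longrightarrow> P m (h \<circ> \<phi> m)) \<Longrightarrow> \<exists>g. P n g \<and> (\<forall>y\<in>A n. g y = h (\<phi> n y))"
    and cong: "\<And>n g g'. \<lbrakk>P n g; \<And>y. y \<in> topspace (Y n) \<Longrightarrow> g y = g' y\<rbrakk> \<Longrightarrow> P n g'"
  shows "\<exists>h. \<forall>n. P n (h \<circ> \<phi> n)"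
proof -
  have step: "\<exists>h'. (\<forall>m<Suc n. P m (h' \<circ> \<phi> m)) \<and> (\<forall>x. x \<notin> cell n \<longrightarrow> h' x = h x)"
    if h: "\<forall>m<n. P m (h \<circ> \<phi> m)" for n and h :: "'x \<Rightarrow> 'v"
  proof -
    obtain g where g: "P n g" "\<And>y. y \<in> A n \<Longrightarrow> g y = h (\<phi> n y)"
      using ext[of n h] h by blast
    \<comment> \<open>Only the values on the stratum \<open>n\<close> change.\<close>
    define h' where
      "h' x = (if x \<in> cell n then g (the_inv_into (topspace (Y n) - A n) (\<phi> n) x) else h x)" for x
    have "P m (h' \<circ> \<phi> m)" if "m < n" for m
    proof (rule cong)
      show "P m (h \<circ> \<phi> m)" using h that by blast
      show "(h \<circ> \<phi> m) y = (h' \<circ> \<phi> m) y" if "y \<in> topspace (Y m)" for y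
      proof -
        have "\<phi> m y \<notin> cell n"
          using map_cell_le[OF that] cell_disjoint \<open>m < n\<close> by (metis leD)
        then show ?thesis by (simp add: h'_def)
      qed
    qed
    moreover have "P n (h' \<circ> \<phi> n)"
    proof (rule cong[OF g(1)])
      show "g y = (h' \<circ> \<phi> n) y" if y: "y \<in> topspace (Y n)" for y
      proof (cases "y \<in> A n")
        case True
        then have "\<phi> n y \<notin> cell n"
          using boundary_cell cell_disjoint by blast
        then show ?thesis using True g(2) by (simp add: h'_def)
      next
        case False
        then have "\<phi> n y \<in> cell n" using y by (auto simp: cell_def)
        then show ?thesis
          using False y by (simp add: h'_def the_inv_into_f_f[OF inj_on_cell])
      qed
    qed
    ultimately show ?thesis
      by (intro exI[of _ h']) (auto simp: less_Suc_eq h'_def)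
  qed
  have "\<exists>H. \<forall>n. (\<forall>m<n. P m (H n \<circ> \<phi> m)) \<and> (\<forall>x. x \<notin> cell n \<longrightarrow> H (Suc n) x = H n x)"
    by (rule dependent_nat_choice[where P = "\<lambda>n h. \<forall>m<n. P m (h \<circ> \<phi> m)"
          and Q = "\<lambda>n h h'. \<forall>x. x \<notin> cell n \<longrightarrow> h' x = h x"]) (simp, rule step)
  then obtain H where H: "\<And>m n. m < n \<Longrightarrow> P m (H n \<circ> \<phi> m)"
    "\<And>n x. x \<notin> cell n \<Longrightarrow> H (Suc n) x = H n x"
    by blast
  have stable: "H N x = H (Suc k) x" if "x \<in> cell k" "Suc k \<le> N" for N k x
    using that(2)
  proof (induction N rule: dec_induct)
    case (step N)
    then have "x \<notin> cell N" using cell_disjoint[OF that(1), of N] by auto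
    then show ?case using step H(2) by simp
  qed simp
  define h where "h x = H (Suc (THE k. x \<in> cell k)) x" for x
  have "P n (h \<circ> \<phi> n)" for n
  proof (rule cong)
    show "P n (H (Suc n) \<circ> \<phi> n)" by (rule H(1)) simp
    show "(H (Suc n) \<circ> \<phi> n) y = (h \<circ> \<phi> n) y" if y: "y \<in> topspace (Y n)" for y
    proof -
      obtain k where k: "k \<le> n" "\<phi> n y \<in> cell k" using map_cell_le[OF y] by blast
      then have "(THE k. \<phi> n y \<in> cell k) = k"
        using cell_disjoint by blast
      then show ?thesis
        using stable[OF k(2), of "Suc n"] k(1) by (simp add: h_def)
    qed
  qed
  then show ?thesis by blast
qed

lemma continuous_map_boundary:
  assumes "\<And>m. m < n \<Longrightarrow> continuous_map (Y m) euclideanreal (h \<circ> \<phi> m)"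
  shows "continuous_map (subtopology (Y n) (A n)) euclideanreal (h \<circ> \<phi> n)"
  unfolding continuous_map_closedin
proof (intro conjI ballI allI impI)
  fix T assume T: "closedin euclideanreal T"
  define C where "C = {x \<in> topspace X. h x \<in> T}"
  have "closedin (Y n) {y \<in> A n. \<phi> n y \<in> C}"
  proof (rule attach)
    fix m assume "m < n"
    have "closedin (Y m) {y \<in> topspace (Y m). (h \<circ> \<phi> m) y \<in> T}"
      by (rule closedin_continuous_map_preimage[OF assms[OF \<open>m < n\<close>] T])
    also have "{y \<in> topspace (Y m). (h \<circ> \<phi> m) y \<in> T} = {y \<in> topspace (Y m). \<phi> m y \<in> C}"
      using map_in by (auto simp: C_def)
    finally show "closedin (Y m) {y \<in> topspace (Y m). \<phi> m y \<in> C}" .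
  qed (auto simp: C_def)
  also have "{y \<in> A n. \<phi> n y \<in> C} = {y \<in> topspace (subtopology (Y n) (A n)). (h \<circ> \<phi> n) y \<in> T}"
    using map_in A_subset by (auto simp: C_def)
  finally show "closedin (subtopology (Y n) (A n))
      {y \<in> topspace (subtopology (Y n) (A n)). (h \<circ> \<phi> n) y \<in> T}"
    using closed_A by (auto simp: closedin_closed_subtopology)
qed auto

lemma continuous_map_from_cells:
  assumes "\<And>n. continuous_map (Y n) euclideanreal (h \<circ> \<phi> n)"
  shows "continuous_map X euclideanreal h"
  unfolding continuous_map_closedin
proof (intro conjI ballI allI impI)
  fix T assume T: "closedin euclideanreal T"
  have "{y \<in> topspace (Y n). (h \<circ> \<phi> n) y \<in> T} =
      {y \<in> topspace (Y n). \<phi> n y \<in> {x \<in> topspace X. h x \<in> T}}" for n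
    using map_in by auto
  then show "closedin X {x \<in> topspace X. h x \<in> T}"
    using closedin_continuous_map_preimage[OF assms T] by (auto simp: closedin_iff)
qed auto

lemma perfectly_normal: "perfectly_normal_space X"
  unfolding perfectly_normal_space_iff
proof (intro allI impI)
  fix C assume C: "closedin X C"
  define P where "P n g \<longleftrightarrow> continuous_map (Y n) euclideanreal g \<and>
    (\<forall>y\<in>topspace (Y n). 0 \<le> g y \<and> (g y = 0 \<longleftrightarrow> \<phi> n y \<in> C))" for n and g :: "'b \<Rightarrow> real"
  have "\<exists>h. \<forall>n. P n (h \<circ> \<phi> n)"
  proof (rule cell_recursion)
    fix n and h :: "'x \<Rightarrow> real" assume h: "\<And>m. m < n \<Longrightarrow> P m (h \<circ> \<phi> m)"
    have bd: "0 \<le> h (\<phi> n y) \<and> (h (\<phi> n y) = 0 \<longleftrightarrow> \<phi> n y \<in> C)" if y: "y \<in> A n" for y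
    proof -
      obtain m z where "m < n" "z \<in> topspace (Y m) - A m" "\<phi> n y = \<phi> m z"
        using boundary[OF y] by blast
      then show ?thesis using h[of m] by (auto simp: P_def)
    qed
    have "\<exists>g. continuous_map (Y n) euclideanreal g \<and> (\<forall>y\<in>A n. g y = (h \<circ> \<phi> n) y) \<and>
        (\<forall>y\<in>topspace (Y n). 0 \<le> g y \<and> (g y = 0 \<longleftrightarrow> y \<in> {y \<in> topspace (Y n). \<phi> n y \<in> C}))"
    proof (rule extend_zero_function)
      show "normal_space (Y n)" "perfectly_normal_space (Y n)"
        using metrizable metrizable_imp_normal_space metrizable_imp_perfectly_normal_space by blast+
      show "closedin (Y n) (A n)" by (rule closed_A)
      show "closedin (Y n) {y \<in> topspace (Y n). \<phi> n y \<in> C}"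
        using C by (simp add: closedin_iff)
      show "continuous_map (subtopology (Y n) (A n)) euclideanreal (h \<circ> \<phi> n)"
        using h by (intro continuous_map_boundary) (simp add: P_def)
    qed (use bd A_subset in auto)
    then show "\<exists>g. P n g \<and> (\<forall>y\<in>A n. g y = h (\<phi> n y))"
      by (auto simp: P_def)
  next
    fix n and g g' :: "'b \<Rightarrow> real" assume "P n g" "\<And>y. y \<in> topspace (Y n) \<Longrightarrow> g y = g' y"
    then show "P n g'"
      using continuous_map_eq[of "Y n" euclideanreal g g'] by (simp add: P_def)
  qed
  then obtain h where h: "\<And>n. P n (h \<circ> \<phi> n)" by blast
  have "continuous_map X euclideanreal h"
    using h by (intro continuous_map_from_cells) (simp add: P_def)
  moreover have "0 \<le> h x \<and> (h x = 0 \<longleftrightarrow> x \<in> C)" if x: "x \<in> topspace X" for x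
  proof -
    obtain n y where "y \<in> topspace (Y n) - A n" "x = \<phi> n y" using cover[OF x] by blast
    then show ?thesis using h[of n] by (auto simp: P_def)
  qed
  ultimately show "\<exists>f. continuous_map X euclideanreal f \<and>
      (\<forall>x\<in>topspace X. 0 \<le> f x \<and> (f x = 0 \<longleftrightarrow> x \<in> C))"
    by blast
qed

text \<open>
  A closed subset of \<open>Y N\<close> that misses \<open>A N\<close> has a closed image, although the stratum of index \<open>N\<close> is
  not closed: the preimage in a later \<open>Y n\<close> lies in \<open>A n\<close>, so \<open>attach\<close> applies.
\<close>

lemma closedin_cell_image:
  assumes K: "closedin (Y N) K" "K \<inter> A N = {}"
  shows "closedin X (\<phi> N ` K)"
proof -
  have KY: "K \<subseteq> topspace (Y N) - A N" using K closedin_subset by blast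
  have KX: "\<phi> N ` K \<subseteq> topspace X" using KY map_in by blast
  have KN: "x \<in> cell N" if "x \<in> \<phi> N ` K" for x using that KY by (auto simp: cell_def)
  have "closedin (Y n) {y \<in> topspace (Y n). \<phi> n y \<in> \<phi> N ` K}" for n
  proof (induction n rule: less_induct)
    case (less n)
    have bd: "closedin (Y n) {y \<in> A n. \<phi> n y \<in> \<phi> N ` K}"
      by (rule attach[OF KX less])
    show ?case
    proof (cases "n = N")
      case True
      have "{y \<in> topspace (Y n). \<phi> n y \<in> \<phi> N ` K} = K"
      proof (intro equalityI subsetI)
        fix y assume y: "y \<in> {y \<in> topspace (Y n). \<phi> n y \<in> \<phi> N ` K}"
        then have "y \<notin> A n"
          using boundary_cell[of y n] cell_disjoint KN True by blast
        then show "y \<in> K"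
          using y KY True inj_on_cell[of N] by (auto simp: inj_on_def)
      qed (use KY True in auto)
      then show ?thesis using K True by simp
    next
      case False
      have "y \<in> A n" if "y \<in> topspace (Y n)" "\<phi> n y \<in> \<phi> N ` K" for y
        using that False KN[OF that(2)] cell_disjoint[of "\<phi> n y" n N] by (auto simp: cell_def)
      then have "{y \<in> topspace (Y n). \<phi> n y \<in> \<phi> N ` K} = {y \<in> A n. \<phi> n y \<in> \<phi> N ` K}"
        using A_subset by blast
      then show ?thesis using bd by simp
    qed
  qed
  then show ?thesis using KX by (simp add: closedin_iff)
qed

lemma Hausdorff: "Hausdorff_space X"
proof (rule perfectly_normal_imp_Hausdorff_space[OF perfectly_normal])
  fix x assume "x \<in> topspace X"
  then obtain n y where y: "y \<in> topspace (Y n) - A n" "x = \<phi> n y" using cover by blast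
  have "closedin (Y n) {y}"
    using y metrizable_imp_Hausdorff_space[OF metrizable] by (simp add: closedin_Hausdorff_singleton)
  then show "closedin X {x}"
    using closedin_cell_image[of n "{y}"] y by simp
qed

lemma k_space: "k_space X"
  unfolding k_space_def
proof (intro allI impI iffI)
  fix S K assume "closedin X S" "compactin X K"
  then show "closedin (subtopology X K) (K \<inter> S)"
    by (simp add: closedin_subtopology_Int_closed)
next
  fix S assume S: "S \<subseteq> topspace X" and "\<forall>K. compactin X K \<longrightarrow> closedin (subtopology X K) (K \<inter> S)"
  then have cl: "\<And>K. compactin X K \<Longrightarrow> closedin (subtopology X K) (K \<inter> S)" by blast
  have "closedin (Y n) {y \<in> topspace (Y n). \<phi> n y \<in> S}" for n
  proof -
    have cont: "continuous_map (Y n) X (\<phi> n)"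
      unfolding continuous_map_closedin using map_in closedin_iff by blast
    have "closedin (subtopology (Y n) K) (K \<inter> {y \<in> topspace (Y n). \<phi> n y \<in> S})"
      if K: "compactin (Y n) K" for K
    proof -
      have "closedin (subtopology X (\<phi> n ` K)) (\<phi> n ` K \<inter> S)"
        by (rule cl[OF image_compactin[OF K cont]])
      moreover have "continuous_map (subtopology (Y n) K) (subtopology X (\<phi> n ` K)) (\<phi> n)"
        using cont by (auto simp: continuous_map_in_subtopology continuous_map_from_subtopology)
      ultimately have "closedin (subtopology (Y n) K)
          {y \<in> topspace (subtopology (Y n) K). \<phi> n y \<in> \<phi> n ` K \<inter> S}"
        by (rule closedin_continuous_map_preimage[rotated])
      moreover have "{y \<in> topspace (subtopology (Y n) K). \<phi> n y \<in> \<phi> n ` K \<inter> S} =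
          K \<inter> {y \<in> topspace (Y n). \<phi> n y \<in> S}"
        by auto
      ultimately show ?thesis by simp
    qed
    then show ?thesis
      using metrizable_imp_k_space[OF metrizable, of n] unfolding k_space_def by auto
  qed
  then show "closedin X S" using S by (simp add: closedin_iff)
qed

text \<open>
  Disjoint open sets of the stratum of index \<open>N\<close> extend to disjoint open sets of \<open>X\<close>. The
  family is encoded as one function \<open>h\<close> with values in \<open>'i option\<close>, where \<open>None\<close> stands for
  the complement of the union; disjointness is then automatic.
\<close>

lemma extend_disjoint_open_cells:
  fixes G :: "'i \<Rightarrow> 'b set"
  assumes G: "\<And>i. openin (Y N) (G i)" "\<And>i. G i \<inter> A N = {}" "\<And>i j. i \<noteq> j \<Longrightarrow> G i \<inter> G j = {}"
  shows "\<exists>Q. (\<forall>i. openin X (Q i) \<and> \<phi> N ` G i \<subseteq> Q i) \<and> (\<forall>i j. i \<noteq> j \<longrightarrow> Q i \<inter> Q j = {})"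
proof -
  define P where "P n g \<longleftrightarrow> (\<forall>i. openin (Y n) {y \<in> topspace (Y n). g y = Some i}) \<and>
      (n < N \<longrightarrow> (\<forall>y\<in>topspace (Y n). g y = None)) \<and>
      (n = N \<longrightarrow> (\<forall>y\<in>topspace (Y n). \<forall>i. g y = Some i \<longleftrightarrow> y \<in> G i))"
    for n and g :: "'b \<Rightarrow> 'i option"
  have "\<exists>h. \<forall>n. P n (h \<circ> \<phi> n)"
  proof (rule cell_recursion)
    fix n and h :: "'x \<Rightarrow> 'i option" assume h: "\<And>m. m < n \<Longrightarrow> P m (h \<circ> \<phi> m)"
    have bd: "h (\<phi> n y) = None" if y: "y \<in> A n" and nN: "n \<le> N" for y
    proof -
      obtain m z where "m < n" "z \<in> topspace (Y m) - A m" "\<phi> n y = \<phi> m z"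
        using boundary[OF y] by blast
      then show ?thesis using h[of m] nN by (auto simp: P_def)
    qed
    consider "n < N" | "n = N" | "N < n" by linarith
    then show "\<exists>g. P n g \<and> (\<forall>y\<in>A n. g y = h (\<phi> n y))"
    proof cases
      case 1
      then show ?thesis
        using bd by (intro exI[of _ "\<lambda>_. None"]) (auto simp: P_def)
    next
      case 2
      have fi: "family_index G y = Some i \<longleftrightarrow> y \<in> G i" for y i
        by (rule family_index_eq_Some[OF G(3)])
      have "{y \<in> topspace (Y n). family_index G y = Some i} = G i" for i
        using openin_subset[OF G(1)[of i]] fi 2 by auto
      then have "P n (family_index G)"
        using G(1) fi 2 by (simp add: P_def)
      moreover have "family_index G y = h (\<phi> n y)" if "y \<in> A n" for y
        using bd[OF that] 2 that G(2) by (auto simp: family_index_def)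
      ultimately show ?thesis by blast
    next
      case 3
      define B where "B i = {y \<in> A n. h (\<phi> n y) = Some i}" for i
      have "openin (subtopology (Y n) (A n)) (B i)" for i
      proof -
        define C where "C = {x \<in> topspace X. h x \<noteq> Some i}"
        have "closedin (Y n) {y \<in> A n. \<phi> n y \<in> C}"
        proof (rule attach)
          fix m assume "m < n"
          have "openin (Y m) {y \<in> topspace (Y m). (h \<circ> \<phi> m) y = Some i}"
            using h[OF \<open>m < n\<close>] unfolding P_def by blast
          also have "{y \<in> topspace (Y m). (h \<circ> \<phi> m) y = Some i} =
              {y \<in> topspace (Y m). \<phi> m y \<in> topspace X - C}"
            using map_in by (auto simp: C_def)
          finally have "openin (Y m) {y \<in> topspace (Y m). \<phi> m y \<in> topspace X - C}" .
          moreover have "topspace X - (topspace X - C) = C" by (auto simp: C_def)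
          ultimately show "closedin (Y m) {y \<in> topspace (Y m). \<phi> m y \<in> C}"
            using openin_preimage_iff[of "topspace X - C" m] by simp
        qed (auto simp: C_def)
        then have "openin (Y n) (topspace (Y n) - {y \<in> A n. \<phi> n y \<in> C})"
          by blast
        moreover have "B i = A n \<inter> (topspace (Y n) - {y \<in> A n. \<phi> n y \<in> C})"
          using A_subset map_in by (auto simp: B_def C_def)
        ultimately show ?thesis
          by (auto simp: openin_subtopology_Int2)
      qed
      then have Bop: "\<forall>i. openin (subtopology (Y n) (A n)) (B i)" ..
      have Bdisj: "\<forall>i j. i \<noteq> j \<longrightarrow> B i \<inter> B j = {}"
        by (auto simp: B_def)
      obtain H where "\<forall>i. openin (Y n) (H i) \<and> H i \<inter> A n = B i" "\<forall>i j. i \<noteq> j \<longrightarrow> H i \<inter> H j = {}"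
        using extend_disjoint_open[OF metrizable A_subset Bop Bdisj] by (elim exE conjE)
      then have H: "\<And>i. openin (Y n) (H i)" "\<And>i. H i \<inter> A n = B i"
        "\<And>i j. i \<noteq> j \<Longrightarrow> H i \<inter> H j = {}"
        by blast+
      have fi: "family_index H y = Some i \<longleftrightarrow> y \<in> H i" for y i
        by (rule family_index_eq_Some[OF H(3)])
      have "{y \<in> topspace (Y n). family_index H y = Some i} = H i" for i
        using openin_subset[OF H(1)[of i]] fi by auto
      then have "P n (family_index H)"
        using H(1) 3 by (simp add: P_def)
      moreover have "family_index H y = h (\<phi> n y)" if "y \<in> A n" for y
      proof -
        have "family_index H y = Some i \<longleftrightarrow> h (\<phi> n y) = Some i" for i
          using H(2)[of i] that by (auto simp: fi B_def)
        then show ?thesis by (metis option.exhaust)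
      qed
      ultimately show ?thesis by blast
    qed
  next
    fix n and g g' :: "'b \<Rightarrow> 'i option"
    assume "P n g" and eq: "\<And>y. y \<in> topspace (Y n) \<Longrightarrow> g y = g' y"
    moreover have "{y \<in> topspace (Y n). g y = Some i} = {y \<in> topspace (Y n). g' y = Some i}" for i
      using eq by auto
    ultimately show "P n g'" by (simp add: P_def)
  qed
  then obtain h where h: "\<And>n. P n (h \<circ> \<phi> n)" by blast
  define Q where "Q i = {x \<in> topspace X. h x = Some i}" for i
  have "openin X (Q i)" for i
  proof -
    have "{y \<in> topspace (Y n). \<phi> n y \<in> Q i} = {y \<in> topspace (Y n). (h \<circ> \<phi> n) y = Some i}" for n
      using map_in by (auto simp: Q_def)
    then show ?thesis
      using h by (auto simp: openin_iff P_def Q_def)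
  qed
  moreover have "\<phi> N ` G i \<subseteq> Q i" for i
    using h[of N] openin_subset[OF G(1)] map_in by (fastforce simp: P_def Q_def)
  moreover have "Q i \<inter> Q j = {}" if "i \<noteq> j" for i j
    using that by (auto simp: Q_def)
  ultimately show ?thesis by blast
qed

text \<open>
  On the stratum of index \<open>N\<close>, take the closed sets \<open>D k U\<close> and disjoint open sets \<open>G k U\<close> given by
  Stone's argument. The union of the \<open>D k U\<close> over \<open>U\<close> is closed in \<open>X\<close>, and the extensions to \<open>X\<close>
  of the \<open>G k U\<close>, intersected with \<open>U\<close>, cover it.
\<close>

lemma cell_sigma_locally_finite_refinement:
  assumes \<U>: "\<And>U. U \<in> \<U> \<Longrightarrow> openin X U" and cov: "\<Union>\<U> = topspace X"
  shows "\<exists>\<V> :: nat \<Rightarrow> 'x set set. (\<forall>k. (\<forall>V\<in>\<V> k. openin X V \<and> (\<exists>U\<in>\<U>. V \<subseteq> U)) \<and>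
    locally_finite_in X (\<V> k)) \<and> cell N \<subseteq> (\<Union>k. \<Union>(\<V> k))"
proof -
  define W where "W U = {y \<in> topspace (Y N). \<phi> N y \<in> U} - A N" for U
  have "\<forall>U\<in>\<U>. openin (Y N) (W U)"
    using \<U> closed_A by (auto simp: W_def openin_iff)
  from metrizable_sigma_discrete_refinement[OF metrizable this]
  obtain D G :: "nat \<Rightarrow> 'x set \<Rightarrow> 'b set" where
    DG: "\<forall>k. \<forall>U\<in>\<U>. D k U \<subseteq> G k U \<and> G k U \<subseteq> W U \<and> openin (Y N) (G k U)"
    and disj: "\<forall>k. \<forall>U\<in>\<U>. \<forall>U'\<in>\<U>. U \<noteq> U' \<longrightarrow> G k U \<inter> G k U' = {}"
    and Dcl: "\<forall>k. closedin (Y N) (\<Union>U\<in>\<U>. D k U)"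
    and Dcov: "(\<Union>U\<in>\<U>. W U) = (\<Union>k. \<Union>U\<in>\<U>. D k U)"
    by (elim exE conjE)
  have "\<exists>\<V>. (\<forall>V\<in>\<V>. openin X V \<and> (\<exists>U\<in>\<U>. V \<subseteq> U)) \<and> \<phi> N ` (\<Union>U\<in>\<U>. D k U) \<subseteq> \<Union>\<V> \<and>
      locally_finite_in X \<V>" for k
  proof -
    define G' where "G' U = (if U \<in> \<U> then G k U else {})" for U
    have "\<exists>Q. (\<forall>U. openin X (Q U) \<and> \<phi> N ` G' U \<subseteq> Q U) \<and> (\<forall>U U'. U \<noteq> U' \<longrightarrow> Q U \<inter> Q U' = {})"
    proof (rule extend_disjoint_open_cells)
      show "openin (Y N) (G' U)" for U using DG by (simp add: G'_def)
      show "G' U \<inter> A N = {}" for U using DG by (auto simp: G'_def W_def)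
      show "G' U \<inter> G' U' = {}" if "U \<noteq> U'" for U U' using disj that by (simp add: G'_def)
    qed
    then obtain Q where Q': "\<forall>U. openin X (Q U) \<and> \<phi> N ` G' U \<subseteq> Q U"
      "\<forall>U U'. U \<noteq> U' \<longrightarrow> Q U \<inter> Q U' = {}"
      by (elim exE conjE)
    have Q: "openin X (Q U)" "\<phi> N ` G' U \<subseteq> Q U" for U
      using Q'(1) by simp_all
    have Qdisj: "Q U \<inter> Q U' = {}" if "U \<noteq> U'" for U U'
      using Q'(2) that by simp
    have "\<exists>\<V>. (\<forall>V\<in>\<V>. openin X V \<and> (\<exists>U\<in>\<U>. V \<subseteq> Q U \<inter> U)) \<and> \<phi> N ` (\<Union>U\<in>\<U>. D k U) \<subseteq> \<Union>\<V> \<and>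
        locally_finite_in X \<V>"
    proof (rule disjoint_open_shrink_locally_finite[OF perfectly_normal])
      have "\<forall>U\<in>\<U>. D k U \<inter> A N = {}"
        using DG by (fastforce simp: W_def)
      then have "(\<Union>U\<in>\<U>. D k U) \<inter> A N = {}" by blast
      then show "closedin X (\<phi> N ` (\<Union>U\<in>\<U>. D k U))"
        using Dcl by (intro closedin_cell_image) simp_all
      show "openin X (Q U \<inter> U)" if "U \<in> \<U>" for U
        using Q(1) \<U>[OF that] by blast
      show "Q U \<inter> U \<inter> (Q U' \<inter> U') = {}" if "U \<noteq> U'" for U U'
        using Qdisj[OF that] by blast
      show "\<phi> N ` (\<Union>U\<in>\<U>. D k U) \<subseteq> (\<Union>U\<in>\<U>. Q U \<inter> U)"
      proof (rule image_subsetI)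
        fix y assume "y \<in> (\<Union>U\<in>\<U>. D k U)"
        then obtain U where U: "U \<in> \<U>" "y \<in> D k U" by blast
        then have "y \<in> G k U" "y \<in> W U" using DG by blast+
        then have "\<phi> N y \<in> Q U \<inter> U"
          using Q(2)[of U] U(1) by (auto simp: G'_def W_def)
        then show "\<phi> N y \<in> (\<Union>U\<in>\<U>. Q U \<inter> U)" using U(1) by blast
      qed
    qed
    then show ?thesis by (meson le_infE)
  qed
  from choice[OF allI, OF this] obtain \<V> where
    \<V>: "\<forall>k. (\<forall>V\<in>\<V> k. openin X V \<and> (\<exists>U\<in>\<U>. V \<subseteq> U)) \<and> \<phi> N ` (\<Union>U\<in>\<U>. D k U) \<subseteq> \<Union>(\<V> k) \<and>
      locally_finite_in X (\<V> k)" ..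
  have "cell N \<subseteq> (\<Union>k. \<Union>(\<V> k))"
  proof
    fix x assume "x \<in> cell N"
    then obtain y where y: "y \<in> topspace (Y N) - A N" "x = \<phi> N y" by (auto simp: cell_def)
    then obtain U where "U \<in> \<U>" "x \<in> U" using map_in[of y N] cov by blast
    then have "y \<in> (\<Union>U\<in>\<U>. W U)" using y by (auto simp: W_def)
    then obtain k where k: "y \<in> (\<Union>U\<in>\<U>. D k U)" unfolding Dcov by blast
    have "\<phi> N ` (\<Union>U\<in>\<U>. D k U) \<subseteq> \<Union>(\<V> k)" using \<V> by simp
    from subsetD[OF this imageI[OF k]] show "x \<in> (\<Union>k. \<Union>(\<V> k))"
      unfolding y(2) by (rule UN_I[OF UNIV_I])
  qed
  then show ?thesis using \<V> by (intro exI[of _ \<V>]) simp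
qed

lemma paracompact: "paracompact_space X"
  unfolding paracompact_space_def
proof (intro conjI Hausdorff allI impI)
  fix \<U> assume \<U>: "(\<forall>U\<in>\<U>. openin X U) \<and> \<Union>\<U> = topspace X"
  then have "\<forall>N. \<exists>\<V> :: nat \<Rightarrow> 'x set set. (\<forall>k. (\<forall>V\<in>\<V> k. openin X V \<and> (\<exists>U\<in>\<U>. V \<subseteq> U)) \<and>
      locally_finite_in X (\<V> k)) \<and> cell N \<subseteq> (\<Union>k. \<Union>(\<V> k))"
    by (intro allI cell_sigma_locally_finite_refinement) auto
  from choice[OF this] obtain \<V> :: "nat \<Rightarrow> nat \<Rightarrow> 'x set set" where
    "\<forall>N. (\<forall>k. (\<forall>V\<in>\<V> N k. openin X V \<and> (\<exists>U\<in>\<U>. V \<subseteq> U)) \<and> locally_finite_in X (\<V> N k)) \<and>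
      cell N \<subseteq> (\<Union>k. \<Union>(\<V> N k))" ..
  then have \<V>: "\<And>N k V. V \<in> \<V> N k \<Longrightarrow> openin X V \<and> (\<exists>U\<in>\<U>. V \<subseteq> U)"
      "\<And>N k. locally_finite_in X (\<V> N k)" "\<And>N. cell N \<subseteq> (\<Union>k. \<Union>(\<V> N k))"
    by (blast, blast, simp)
  define \<V>' where "\<V>' j = \<V> (fst (prod_decode j)) (snd (prod_decode j))" for j
  have "\<exists>\<W>. (\<forall>W\<in>\<W>. openin X W \<and> (\<exists>j. \<exists>V\<in>\<V>' j. W \<subseteq> V)) \<and> \<Union>\<W> = topspace X \<and> locally_finite_in X \<W>"
  proof (rule sigma_locally_finite_refinement[OF perfectly_normal])
    show "openin X V" if "V \<in> \<V>' j" for j V using that \<V>(1) by (auto simp: \<V>'_def)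
    show "locally_finite_in X (\<V>' j)" for j using \<V>(2) by (simp add: \<V>'_def)
    show "(\<Union>j. \<Union>(\<V>' j)) = topspace X"
    proof
      show "(\<Union>j. \<Union>(\<V>' j)) \<subseteq> topspace X"
        using \<open>\<And>j V. V \<in> \<V>' j \<Longrightarrow> openin X V\<close> openin_subset by blast
      show "topspace X \<subseteq> (\<Union>j. \<Union>(\<V>' j))"
      proof
        fix x assume "x \<in> topspace X"
        then obtain N where "x \<in> cell N" using cover unfolding cell_def by blast
        then obtain k where "x \<in> \<Union>(\<V> N k)" using \<V>(3) by blast
        then have "x \<in> \<Union>(\<V>' (prod_encode (N, k)))" by (simp add: \<V>'_def)
        then show "x \<in> (\<Union>j. \<Union>(\<V>' j))" by blast
      qed
    qed
  qed
  then obtain \<W> where \<W>: "\<forall>W\<in>\<W>. openin X W \<and> (\<exists>j. \<exists>V\<in>\<V>' j. W \<subseteq> V)" "\<Union>\<W> = topspace X"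
    "locally_finite_in X \<W>"
    by (elim exE conjE)
  have "\<exists>U\<in>\<U>. W \<subseteq> U" if "W \<in> \<W>" for W
  proof -
    obtain j V where "V \<in> \<V>' j" "W \<subseteq> V" using \<W>(1) \<open>W \<in> \<W>\<close> by blast
    moreover then obtain U where "U \<in> \<U>" "V \<subseteq> U" using \<V>(1) unfolding \<V>'_def by blast
    ultimately show ?thesis by blast
  qed
  then show "\<exists>\<W>. (\<forall>W\<in>\<W>. openin X W) \<and> \<Union>\<W> = topspace X \<and>
      (\<forall>W\<in>\<W>. \<exists>U\<in>\<U>. W \<subseteq> U) \<and> locally_finite_in X \<W>"
    using \<W> by blast
qed

end

section \<open>Morphisms of the simplex category\<close>

lemma DeltaI:
  assumes "\<sigma> \<in> extensional {..m}" "\<And>i. i \<le> m \<Longrightarrow> \<sigma> i \<le> n"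
    and "\<And>i j. i \<le> j \<Longrightarrow> j \<le> m \<Longrightarrow> \<sigma> i \<le> \<sigma> j"
  shows "\<sigma> \<in> Delta m n"
  using assms by (auto simp: Delta_def mono_on_def PiE_iff)

lemma DeltaD:
  assumes "\<sigma> \<in> Delta m n"
  shows "\<sigma> \<in> extensional {..m}" "\<And>i. i \<le> m \<Longrightarrow> \<sigma> i \<le> n"
    "\<And>i j. i \<le> j \<Longrightarrow> j \<le> m \<Longrightarrow> \<sigma> i \<le> \<sigma> j"
  using assms by (auto simp: Delta_def mono_on_def PiE_iff)

lemma Delta_eqI:
  assumes "\<sigma> \<in> Delta m n" "\<tau> \<in> Delta m k" "\<And>i. i \<le> m \<Longrightarrow> \<sigma> i = \<tau> i"
  shows "\<sigma> = \<tau>"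
  using assms by (intro extensionalityI[of \<sigma> "{..m}"]) (auto dest: DeltaD)

lemma compose_atMost [simp]: "i \<le> k \<Longrightarrow> compose {..k} \<sigma> \<tau> i = \<sigma> (\<tau> i)"
  by (simp add: compose_def)

lemma Delta_compose:
  assumes "\<tau> \<in> Delta k m" "\<sigma> \<in> Delta m n"
  shows "compose {..k} \<sigma> \<tau> \<in> Delta k n"
  using DeltaD[OF assms(1)] DeltaD[OF assms(2)] by (intro DeltaI) (auto simp: compose_extensional)

lemma Delta_id: "restrict id {..n} \<in> Delta n n"
  by (intro DeltaI) auto

lemma image_compose_atMost: "compose {..k} \<sigma> \<tau> ` {..k} = \<sigma> ` \<tau> ` {..k}"
  by (force simp: compose_def)

lemma Delta_image_subset: "\<sigma> \<in> Delta m n \<Longrightarrow> \<sigma> ` {..m} \<subseteq> {..n}"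
  by (auto dest: DeltaD)

lemma Delta_surj_le: "\<sigma> ` {..m} = {..n} \<Longrightarrow> n \<le> (m::nat)"
  using card_image_le[of "{..m}" \<sigma>] by simp

lemma Delta_inj_le:
  assumes "\<sigma> \<in> Delta m n" "inj_on \<sigma> {..m}"
  shows "m \<le> n"
  using card_inj_on_le[OF assms(2) Delta_image_subset[OF assms(1)]] by simp

text \<open>Injective morphisms correspond to nonempty subsets of the target.\<close>

lemma Delta_inj_of_subset:
  assumes "S \<subseteq> {..n}" "S \<noteq> {}"
  obtains k \<delta> where "\<delta> \<in> Delta k n" "inj_on \<delta> {..k}" "\<delta> ` {..k} = S"
proof -
  have fin: "finite S" using assms finite_subset by blast
  obtain h where h: "bij_betw h {..<card S} S" "strict_mono_on {..<card S} h"
    using ex_bij_betw_strict_mono_card[OF fin] by blast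
  obtain k where k: "card S = Suc k"
    using fin assms(2) by (metis card_0_eq not0_implies_Suc)
  have eq: "{..<card S} = {..k}" by (auto simp: k)
  have mono: "h i \<le> h j" if "i \<le> j" "j \<le> k" for i j
    using strict_mono_on_imp_mono_on[OF h(2)] that unfolding eq mono_on_def by auto
  have im: "h ` {..k} = S" "inj_on h {..k}"
    using h(1) unfolding eq bij_betw_def by auto
  have "restrict h {..k} \<in> Delta k n"
    using mono im assms(1) by (intro DeltaI) auto
  then show thesis
    using im by (intro that[of "restrict h {..k}"]) (auto simp: inj_on_def)
qed

lemma Delta_inj_unique:
  assumes "\<delta> \<in> Delta k n" "inj_on \<delta> {..k}" "\<delta>' \<in> Delta k' n'" "inj_on \<delta>' {..k'}"
    and "\<delta> ` {..k} = \<delta>' ` {..k'}"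
  shows "k = k'" "\<delta> = \<delta>'"
proof -
  have sorted: "sorted (map \<epsilon> [0..<Suc l])" "distinct (map \<epsilon> [0..<Suc l])"
      "set (map \<epsilon> [0..<Suc l]) = \<epsilon> ` {..l}"
    if "\<epsilon> \<in> Delta l p" "inj_on \<epsilon> {..l}" for \<epsilon> l p
  proof -
    have s: "set [0..<Suc l] = {..l}" by auto
    show "set (map \<epsilon> [0..<Suc l]) = \<epsilon> ` {..l}" unfolding set_map s ..
    show "distinct (map \<epsilon> [0..<Suc l])" unfolding distinct_map s using that by simp
    show "sorted (map \<epsilon> [0..<Suc l])"
      using DeltaD(3)[OF that(1)] unfolding sorted_iff_nth_mono by (simp del: upt_Suc)
  qed
  \<comment> \<open>Both sides are the increasing enumeration of the common image.\<close>
  have eq: "map \<delta> [0..<Suc k] = map \<delta>' [0..<Suc k']"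
    using assms(5) by (intro sorted_distinct_set_unique sorted[OF assms(1,2)] sorted[OF assms(3,4)])
      (simp only: sorted(3)[OF assms(1,2)] sorted(3)[OF assms(3,4)])
  then show k: "k = k'" by (metis length_map length_upt diff_zero nat.inject)
  have "\<delta> i = \<delta>' i" if "i \<le> k" for i
    using arg_cong[OF eq, of "\<lambda>xs. xs ! i"] that k by (simp del: upt_Suc)
  then show "\<delta> = \<delta>'" using assms(1,3) k by (intro Delta_eqI) auto
qed

lemma Delta_inj_endo:
  assumes "\<delta> \<in> Delta k k" "inj_on \<delta> {..k}"
  shows "\<delta> = restrict id {..k}"
proof (rule Delta_inj_unique[OF assms Delta_id])
  show "inj_on (restrict id {..k}) {..k}" by (auto simp: inj_on_def)
  show "\<delta> ` {..k} = restrict id {..k} ` {..k}"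
    using card_subset_eq[OF _ Delta_image_subset[OF assms(1)]] card_image[OF assms(2)] by simp
qed

text \<open>Factorization into a surjection followed by an injection.\<close>

lemma Delta_factor:
  assumes \<sigma>: "\<sigma> \<in> Delta m n"
  obtains k \<delta> \<tau> where "\<delta> \<in> Delta k n" "inj_on \<delta> {..k}" "\<tau> \<in> Delta m k" "\<tau> ` {..m} = {..k}"
    "\<sigma> = compose {..m} \<delta> \<tau>"
proof -
  have "\<sigma> ` {..m} \<noteq> {}" by simp
  then obtain k \<delta> where \<delta>: "\<delta> \<in> Delta k n" "inj_on \<delta> {..k}" "\<delta> ` {..k} = \<sigma> ` {..m}"
    by (rule Delta_inj_of_subset[OF Delta_image_subset[OF \<sigma>]])
  define \<tau> where "\<tau> = restrict (\<lambda>i. the_inv_into {..k} \<delta> (\<sigma> i)) {..m}"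
  have \<tau>: "\<tau> i \<le> k" "\<delta> (\<tau> i) = \<sigma> i" if "i \<le> m" for i
  proof -
    have "\<sigma> i \<in> \<delta> ` {..k}" using that \<delta>(3) by simp
    then show "\<tau> i \<le> k" "\<delta> (\<tau> i) = \<sigma> i"
      using that the_inv_into_into[OF \<delta>(2) _ order_refl] f_the_inv_into_f[OF \<delta>(2)]
      by (auto simp: \<tau>_def)
  qed
  have \<tau>\<Delta>: "\<tau> \<in> Delta m k"
  proof (rule DeltaI)
    fix i j assume ij: "i \<le> j" "j \<le> m"
    show "\<tau> i \<le> \<tau> j"
    proof (rule ccontr)
      assume "\<not> \<tau> i \<le> \<tau> j"
      then have "\<delta> (\<tau> j) \<le> \<delta> (\<tau> i)"
        using DeltaD(3)[OF \<delta>(1), of "\<tau> j" "\<tau> i"] \<tau>(1)[of i] ij by simp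
      moreover have "\<sigma> i \<le> \<sigma> j" using DeltaD(3)[OF \<sigma> ij] .
      ultimately have "\<delta> (\<tau> j) = \<delta> (\<tau> i)" using \<tau>(2) ij by simp
      then have "\<tau> j = \<tau> i" using \<delta>(2) \<tau>(1) ij by (auto dest: inj_onD)
      then show False using \<open>\<not> \<tau> i \<le> \<tau> j\<close> by simp
    qed
  qed (use \<tau> in \<open>auto simp: \<tau>_def\<close>)
  have "j \<in> \<tau> ` {..m}" if "j \<le> k" for j
  proof -
    have "\<delta> j \<in> \<sigma> ` {..m}" unfolding \<delta>(3)[symmetric] using that by simp
    then obtain i where i: "i \<le> m" "\<delta> j = \<sigma> i" by auto
    then have "\<tau> i = j" using inj_onD[OF \<delta>(2), of "\<tau> i" j] \<tau>[of i] that by simp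
    then show ?thesis using i by auto
  qed
  then have "\<tau> ` {..m} = {..k}" using \<tau>(1) by auto
  moreover have "\<sigma> = compose {..m} \<delta> \<tau>"
    by (rule Delta_eqI[OF \<sigma> Delta_compose[OF \<tau>\<Delta> \<delta>(1)]]) (simp add: \<tau>)
  ultimately show thesis using that \<delta> \<tau>\<Delta> by blast
qed

text \<open>A section of a surjective morphism can be chosen with any one value prescribed.\<close>

lemma Delta_section:
  assumes \<sigma>: "\<sigma> \<in> Delta m n" "\<sigma> ` {..m} = {..n}" and t: "t \<le> m"
  obtains d where "d \<in> Delta n m" "compose {..n} \<sigma> d = restrict id {..n}" "d (\<sigma> t) = t"
proof -
  define d where "d = restrict (\<lambda>j. if j = \<sigma> t then t else (SOME i. i \<le> m \<and> \<sigma> i = j)) {..n}"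
  have d: "d j \<le> m" "\<sigma> (d j) = j" if "j \<le> n" for j
  proof -
    have "\<exists>i. i \<le> m \<and> \<sigma> i = j" using \<sigma>(2) that by (metis atMost_iff imageE)
    then have "(SOME i. i \<le> m \<and> \<sigma> i = j) \<le> m \<and> \<sigma> (SOME i. i \<le> m \<and> \<sigma> i = j) = j"
      by (rule someI_ex)
    then show "d j \<le> m" "\<sigma> (d j) = j" using that t by (auto simp: d_def)
  qed
  \<comment> \<open>A set-theoretic section of a monotone map is monotone.\<close>
  have \<Delta>: "d \<in> Delta n m"
  proof (rule DeltaI)
    show "d i \<le> d j" if ij: "i \<le> j" "j \<le> n" for i j
      using DeltaD(3)[OF \<sigma>(1), of "d j" "d i"] d[of i] d[of j] ij by (cases "d i \<le> d j") auto
    show "d \<in> extensional {..n}" by (simp add: d_def)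
    show "d i \<le> m" if "i \<le> n" for i by (rule d(1)[OF that])
  qed
  moreover have "compose {..n} \<sigma> d = restrict id {..n}"
    by (rule Delta_eqI[OF Delta_compose[OF \<Delta> \<sigma>(1)] Delta_id]) (simp add: d)
  moreover have "d (\<sigma> t) = t" using DeltaD(2)[OF \<sigma>(1) t] by (simp add: d_def)
  ultimately show thesis by (rule that)
qed

lemma Delta_retraction:
  assumes \<delta>: "\<delta> \<in> Delta k n" "inj_on \<delta> {..k}"
  obtains s where "s \<in> Delta n k" "compose {..k} s \<delta> = restrict id {..k}"
proof -
  \<comment> \<open>The largest \<open>i\<close> with \<open>\<delta> i \<le> j\<close>, or \<open>0\<close> if there is none.\<close>
  define s where "s = restrict (\<lambda>j. Max {i. i \<le> k \<and> (i = 0 \<or> \<delta> i \<le> j)}) {..n}"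
  have fin: "finite {i. i \<le> k \<and> (i = 0 \<or> \<delta> i \<le> j)}" and ne: "{i. i \<le> k \<and> (i = 0 \<or> \<delta> i \<le> j)} \<noteq> {}" for j
    by auto
  have \<Delta>: "s \<in> Delta n k"
  proof (rule DeltaI)
    show "s j \<le> k" if "j \<le> n" for j
      using Max_in[OF fin ne, of j] that by (simp add: s_def)
    show "s i \<le> s j" if "i \<le> j" "j \<le> n" for i j
      using that Max_mono[OF _ ne fin, of i j] by (force simp: s_def)
  qed (simp add: s_def)
  moreover have "compose {..k} s \<delta> = restrict id {..k}"
  proof (rule Delta_eqI[OF Delta_compose[OF \<delta>(1) \<Delta>] Delta_id])
    fix i assume i: "i \<le> k"
    have "Max {i'. i' \<le> k \<and> (i' = 0 \<or> \<delta> i' \<le> \<delta> i)} = i"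
    proof (rule Max_eqI[OF fin])
      fix j assume j: "j \<in> {i'. i' \<le> k \<and> (i' = 0 \<or> \<delta> i' \<le> \<delta> i)}"
      show "j \<le> i"
      proof (rule ccontr)
        assume "\<not> j \<le> i"
        then have "\<delta> j = \<delta> i" using j DeltaD(3)[OF \<delta>(1), of i j] by auto
        then show False using \<delta>(2) i j \<open>\<not> j \<le> i\<close> by (auto dest: inj_onD)
      qed
    qed (use i in auto)
    then show "compose {..k} s \<delta> i = restrict id {..k} i"
      using i DeltaD(2)[OF \<delta>(1) i] by (simp add: s_def)
  qed
  ultimately show thesis by (rule that)
qed

section \<open>The Eilenberg-Zilber lemma\<close>

context simplicial_set
begin

text \<open>
  An element of \<open>F m\<close> is nondegenerate if it is not of the form \<open>\<gamma>\<sigma>\<close> with a surjective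
  \<open>\<sigma> : [m] \<rightarrow> [k]\<close>, \<open>k \<noteq> m\<close>; surjectivity already forces \<open>k \<le> m\<close>.
\<close>

definition nondegenerate :: "nat \<Rightarrow> 'a set" where
  "nondegenerate m = {\<beta> \<in> F m. \<forall>k \<sigma> \<gamma>. \<sigma> \<in> Delta m k \<longrightarrow> \<sigma> ` {..m} = {..k} \<longrightarrow> \<gamma> \<in> F k \<longrightarrow>
     \<beta> = act m k \<sigma> \<gamma> \<longrightarrow> k = m}"

lemma nondegenerate_subset: "\<beta> \<in> nondegenerate m \<Longrightarrow> \<beta> \<in> F m"
  by (simp add: nondegenerate_def)

lemma Eilenberg_Zilber_exists:
  assumes \<alpha>: "\<alpha> \<in> F n"
  obtains m \<sigma> \<beta> where "m \<le> n" "\<sigma> \<in> Delta n m" "\<sigma> ` {..n} = {..m}" "\<beta> \<in> nondegenerate m"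
    "\<alpha> = act n m \<sigma> \<beta>"
proof -
  define R where "R m \<longleftrightarrow> (\<exists>\<sigma> \<beta>. \<sigma> \<in> Delta n m \<and> \<sigma> ` {..n} = {..m} \<and> \<beta> \<in> F m \<and> \<alpha> = act n m \<sigma> \<beta>)" for m
  have "R n"
    unfolding R_def using Delta_id \<alpha> act_id[OF \<alpha>] by (intro exI[of _ "restrict id {..n}"] exI[of _ \<alpha>]) auto
  define m where "m = (LEAST m. R m)"
  have "R m" "\<And>k. R k \<Longrightarrow> m \<le> k"
    unfolding m_def using \<open>R n\<close> by (auto intro: LeastI Least_le)
  then obtain \<sigma> \<beta> where \<sigma>: "\<sigma> \<in> Delta n m" "\<sigma> ` {..n} = {..m}" "\<beta> \<in> F m" "\<alpha> = act n m \<sigma> \<beta>"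
    unfolding R_def by blast
  have "k = m" if "\<tau> \<in> Delta m k" "\<tau> ` {..m} = {..k}" "\<gamma> \<in> F k" "\<beta> = act m k \<tau> \<gamma>" for k \<tau> \<gamma>
  proof -
    have "compose {..n} \<tau> \<sigma> ` {..n} = {..k}"
      using that(2) \<sigma>(2) by (simp only: image_compose_atMost)
    then have "R k"
      unfolding R_def using that \<sigma> act_comp[OF \<sigma>(1) that(1,3)] Delta_compose[OF \<sigma>(1) that(1)]
      by (intro exI[of _ "compose {..n} \<tau> \<sigma>"] exI[of _ \<gamma>]) simp
    then have "m \<le> k" using \<open>\<And>k. R k \<Longrightarrow> m \<le> k\<close> by blast
    moreover have "k \<le> m" using Delta_surj_le[OF that(2)] .
    ultimately show ?thesis by simp
  qed
  then have "\<beta> \<in> nondegenerate m"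
    using \<sigma>(3) unfolding nondegenerate_def by blast
  then show thesis using that \<sigma> Delta_surj_le[OF \<sigma>(2)] by blast
qed

text \<open>If \<open>\<rho>\<close> were not injective, its surjective part would be a degeneracy of \<open>\<beta>\<close>.\<close>

lemma nondegenerate_act:
  assumes \<beta>: "\<beta> \<in> nondegenerate m" and \<rho>: "\<rho> \<in> Delta m m'" and \<beta>': "\<beta>' \<in> F m'"
    and eq: "\<beta> = act m m' \<rho> \<beta>'"
  shows "inj_on \<rho> {..m}"
proof -
  obtain k \<delta> \<tau> where \<delta>: "\<delta> \<in> Delta k m'" "inj_on \<delta> {..k}" and \<tau>: "\<tau> \<in> Delta m k" "\<tau> ` {..m} = {..k}"
    and \<rho>': "\<rho> = compose {..m} \<delta> \<tau>"
    by (rule Delta_factor[OF \<rho>])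
  have "\<beta> = act m k \<tau> (act k m' \<delta> \<beta>')"
    using eq act_comp[OF \<tau>(1) \<delta>(1) \<beta>'] by (simp add: \<rho>')
  then have "k = m"
    using \<beta> \<tau> act_closed[OF \<delta>(1) \<beta>'] unfolding nondegenerate_def by blast
  then have "inj_on \<tau> {..m}" using \<tau>(2) by (intro eq_card_imp_inj_on) auto
  then have "inj_on (\<delta> \<circ> \<tau>) {..m}"
    using \<delta>(2) \<tau>(2) by (simp add: comp_inj_on)
  then show ?thesis
    by (simp add: \<rho>' inj_on_def)
qed

text \<open>
  Composing with a section \<open>d\<close> of \<open>\<sigma>\<close> gives \<open>\<beta> = \<beta>'(\<sigma>'d)\<close>, so \<open>\<sigma>'d\<close> is injective. By symmetry both
  dimensions agree, hence \<open>\<sigma>'d\<close> is the identity for every section \<open>d\<close> of \<open>\<sigma>\<close>. As every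
  element lies in the range of some section, \<open>\<sigma> = \<sigma>'\<close>.
\<close>

lemma Eilenberg_Zilber_unique:
  assumes \<sigma>: "\<sigma> \<in> Delta n m" "\<sigma> ` {..n} = {..m}" and \<beta>: "\<beta> \<in> nondegenerate m"
    and \<sigma>': "\<sigma>' \<in> Delta n m'" "\<sigma>' ` {..n} = {..m'}" and \<beta>': "\<beta>' \<in> nondegenerate m'"
    and eq: "act n m \<sigma> \<beta> = act n m' \<sigma>' \<beta>'"
  shows "m = m'" "\<sigma> = \<sigma>'" "\<beta> = \<beta>'"
proof -
  have sect: "\<beta>1 = act m1 m2 (compose {..m1} \<sigma>2 d) \<beta>2"
    if "\<sigma>1 \<in> Delta n m1" "\<beta>1 \<in> F m1" "\<sigma>2 \<in> Delta n m2" "\<beta>2 \<in> F m2"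
      "act n m1 \<sigma>1 \<beta>1 = act n m2 \<sigma>2 \<beta>2" "d \<in> Delta m1 n" "compose {..m1} \<sigma>1 d = restrict id {..m1}"
    for m1 m2 \<sigma>1 \<sigma>2 \<beta>1 \<beta>2 d
    using act_comp[OF that(6,1,2)] act_comp[OF that(6,3,4)] act_id[OF that(2)] that(5,7) by simp
  note F = nondegenerate_subset[OF \<beta>] nondegenerate_subset[OF \<beta>']
  have le: "m1 \<le> m2"
    if "\<sigma>1 \<in> Delta n m1" "\<sigma>1 ` {..n} = {..m1}" "\<beta>1 \<in> nondegenerate m1" "\<sigma>2 \<in> Delta n m2"
      "\<beta>2 \<in> F m2" "act n m1 \<sigma>1 \<beta>1 = act n m2 \<sigma>2 \<beta>2" for m1 m2 \<sigma>1 \<sigma>2 \<beta>1 \<beta>2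
  proof -
    have "\<exists>d. d \<in> Delta m1 n \<and> compose {..m1} \<sigma>1 d = restrict id {..m1}"
      by (rule Delta_section[OF that(1,2) le0]) blast
    then obtain d where d: "d \<in> Delta m1 n" "compose {..m1} \<sigma>1 d = restrict id {..m1}"
      by blast
    have \<Delta>: "compose {..m1} \<sigma>2 d \<in> Delta m1 m2" by (rule Delta_compose[OF d(1) that(4)])
    have "inj_on (compose {..m1} \<sigma>2 d) {..m1}"
      using sect[OF that(1) nondegenerate_subset[OF that(3)] that(4,5,6) d]
      by (rule nondegenerate_act[OF that(3) \<Delta> that(5)])
    then show ?thesis using Delta_inj_le[OF \<Delta>] by blast
  qed
  show m: "m = m'"
    using le[OF \<sigma> \<beta> \<sigma>'(1) F(2) eq] le[OF \<sigma>' \<beta>' \<sigma>(1) F(1) eq[symmetric]] by simp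
  have id: "compose {..m} \<sigma>' d = restrict id {..m}"
    and \<beta>id: "\<beta> = act m m' (restrict id {..m}) \<beta>'"
    if d: "d \<in> Delta m n" "compose {..m} \<sigma> d = restrict id {..m}" for d
  proof -
    have \<Delta>: "compose {..m} \<sigma>' d \<in> Delta m m'" by (rule Delta_compose[OF d(1) \<sigma>'(1)])
    have s: "\<beta> = act m m' (compose {..m} \<sigma>' d) \<beta>'"
      by (rule sect[OF \<sigma>(1) F(1) \<sigma>'(1) F(2) eq d])
    have "inj_on (compose {..m} \<sigma>' d) {..m}"
      by (rule nondegenerate_act[OF \<beta> \<Delta> F(2) s])
    then show "compose {..m} \<sigma>' d = restrict id {..m}"
      using Delta_inj_endo \<Delta> m by blast
    then show "\<beta> = act m m' (restrict id {..m}) \<beta>'" using s by simp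
  qed
  have "\<sigma> t = \<sigma>' t" if t: "t \<le> n" for t
  proof -
    obtain d where d: "d \<in> Delta m n" "compose {..m} \<sigma> d = restrict id {..m}" "d (\<sigma> t) = t"
      by (rule Delta_section[OF \<sigma> t])
    have "\<sigma> t \<le> m" using DeltaD(2)[OF \<sigma>(1) t] .
    then have "compose {..m} \<sigma>' d (\<sigma> t) = \<sigma> t" using id[OF d(1,2)] by simp
    then show ?thesis using d(3) \<open>\<sigma> t \<le> m\<close> by simp
  qed
  then show "\<sigma> = \<sigma>'" using \<sigma>(1) \<sigma>'(1) by (intro Delta_eqI)
  obtain d where d: "d \<in> Delta m n" "compose {..m} \<sigma> d = restrict id {..m}"
    using Delta_section[OF \<sigma> le0] by metis
  show "\<beta> = \<beta>'"
    using \<beta>id[OF d] act_id[OF F(2)] m by simp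
qed

end

section \<open>Maps and essential images in the spaces \<open>\<nabla>\<^sub>n\<close>\<close>

lemma nablaE:
  assumes "a \<in> nabla M n"
  obtains f where "f \<in> measurable M (count_space {..n})" "a = ae_rel M n `` {f}"
  using assms unfolding nabla_def by (rule quotientE)

lemma ae_class_eq_iff:
  assumes "f \<in> measurable M (count_space {..n})" "g \<in> measurable M (count_space {..n})"
  shows "ae_rel M n `` {f} = ae_rel M n `` {g} \<longleftrightarrow> (AE t in M. f t = g t)"
  using eq_equiv_class_iff[OF equiv_ae_rel assms] assms by (simp add: ae_rel_def)

lemma measurable_le: "\<lbrakk>f \<in> measurable M (count_space {..n::nat}); t \<in> space M\<rbrakk> \<Longrightarrow> f t \<le> n"
  by (drule (1) measurable_space) simp

lemma nabla_map_compose: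
  assumes \<tau>: "\<tau> \<in> Delta k m" and \<sigma>: "\<sigma> \<in> Delta m n" and a: "a \<in> nabla M k"
  shows "nabla_map M n (compose {..k} \<sigma> \<tau>) a = nabla_map M n \<sigma> (nabla_map M m \<tau> a)"
proof -
  obtain f where f: "f \<in> measurable M (count_space {..k})" "a = ae_rel M k `` {f}"
    using a by (rule nablaE)
  have "AE t in M. (compose {..k} \<sigma> \<tau> \<circ> f) t = (\<sigma> \<circ> (\<tau> \<circ> f)) t"
    using measurable_le[OF f(1)] by (intro AE_I2) simp
  then have "ae_rel M n `` {compose {..k} \<sigma> \<tau> \<circ> f} = ae_rel M n `` {\<sigma> \<circ> (\<tau> \<circ> f)}"
    using ae_class_eq_iff[OF measurable_Delta_comp[OF Delta_compose[OF \<tau> \<sigma>] f(1)]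
        measurable_Delta_comp[OF \<sigma> measurable_Delta_comp[OF \<tau> f(1)]]] by simp
  then show ?thesis
    using nabla_map_class[OF Delta_compose[OF \<tau> \<sigma>] f(1)] nabla_map_class[OF \<tau> f(1)]
      nabla_map_class[OF \<sigma> measurable_Delta_comp[OF \<tau> f(1)]] f(2) by simp
qed

lemma nabla_map_id:
  assumes a: "a \<in> nabla M n"
  shows "nabla_map M n (restrict id {..n}) a = a"
proof -
  obtain f where f: "f \<in> measurable M (count_space {..n})" "a = ae_rel M n `` {f}"
    using a by (rule nablaE)
  have "AE t in M. (restrict id {..n} \<circ> f) t = f t"
    using measurable_le[OF f(1)] by (intro AE_I2) simp
  then show ?thesis
    using ae_class_eq_iff[OF measurable_Delta_comp[OF Delta_id f(1)] f(1)]
      nabla_map_class[OF Delta_id f(1)] f(2) by simp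
qed

text \<open>
  The values that a class attains with positive probability. All representatives of an element of
  \<open>nabla M n\<close> attain the same ones, see \<open>essential_image_class\<close>.
\<close>

definition essential_image :: "'w measure \<Rightarrow> ('w \<Rightarrow> nat) set \<Rightarrow> nat set" where
  "essential_image M a = {i. \<exists>f\<in>a. \<not> (AE t in M. f t \<noteq> i)}"

lemma essential_image_class:
  assumes f: "f \<in> measurable M (count_space {..n})"
  shows "essential_image M (ae_rel M n `` {f}) = {i. \<not> (AE t in M. f t \<noteq> i)}"
proof -
  have "(AE t in M. g t \<noteq> i) \<longleftrightarrow> (AE t in M. f t \<noteq> i)" if "(f, g) \<in> ae_rel M n" for g i
  proof -
    have "AE t in M. f t = g t" using that by (simp add: ae_rel_def)
    then have "AE t in M. (g t \<noteq> i) = (f t \<noteq> i)" by eventually_elim simp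
    then show ?thesis by (rule eventually_subst)
  qed
  moreover have "(f, f) \<in> ae_rel M n" using f by (simp add: ae_rel_def)
  ultimately show ?thesis unfolding essential_image_def by blast
qed

lemma essential_image_subset:
  assumes "a \<in> nabla M n"
  shows "essential_image M a \<subseteq> {..n}"
proof -
  obtain f where f: "f \<in> measurable M (count_space {..n})" "a = ae_rel M n `` {f}"
    using assms by (rule nablaE)
  have "AE t in M. f t \<noteq> i" if "\<not> i \<le> n" for i
    using measurable_le[OF f(1)] that by (intro AE_I2) auto
  then show ?thesis by (auto simp: f(2) essential_image_class[OF f(1)])
qed

lemma AE_in_essential_image:
  assumes f: "f \<in> measurable M (count_space {..n})"
  shows "AE t in M. f t \<in> essential_image M (ae_rel M n `` {f})"
proof -
  have "AE t in M. \<forall>i\<in>{..n} - essential_image M (ae_rel M n `` {f}). f t \<noteq> i"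
    by (rule AE_finite_allI) (auto simp: essential_image_class[OF f])
  moreover have "AE t in M. f t \<in> {..n}"
    using measurable_le[OF f] by (intro AE_I2) simp
  ultimately show ?thesis by eventually_elim blast
qed

lemma essential_image_map:
  assumes \<sigma>: "\<sigma> \<in> Delta m n" and a: "a \<in> nabla M m"
  shows "essential_image M (nabla_map M n \<sigma> a) = \<sigma> ` essential_image M a"
proof -
  obtain f where f: "f \<in> measurable M (count_space {..m})" "a = ae_rel M m `` {f}"
    using a by (rule nablaE)
  have eq: "essential_image M (nabla_map M n \<sigma> a) = {j. \<not> (AE t in M. \<sigma> (f t) \<noteq> j)}"
    using essential_image_class[OF measurable_Delta_comp[OF \<sigma> f(1)]]
    by (simp add: f(2) nabla_map_class[OF \<sigma> f(1)])
  have "(AE t in M. \<sigma> (f t) \<noteq> j) \<longleftrightarrow> j \<notin> \<sigma> ` essential_image M a" for j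
  proof
    assume "AE t in M. \<sigma> (f t) \<noteq> j"
    then have "AE t in M. f t \<noteq> i" if "\<sigma> i = j" for i
      using that by (auto elim: eventually_mono)
    then show "j \<notin> \<sigma> ` essential_image M a"
      by (auto simp: f(2) essential_image_class[OF f(1)])
  next
    assume j: "j \<notin> \<sigma> ` essential_image M a"
    have "AE t in M. f t \<in> essential_image M a"
      using AE_in_essential_image[OF f(1)] f(2) by simp
    then show "AE t in M. \<sigma> (f t) \<noteq> j"
      by eventually_elim (use j in blast)
  qed
  then show ?thesis by (auto simp: eq)
qed

lemma essential_image_nonempty:
  assumes "prob_space M" "a \<in> nabla M n"
  shows "essential_image M a \<noteq> {}"
proof
  assume empty: "essential_image M a = {}"
  obtain f where f: "f \<in> measurable M (count_space {..n})" "a = ae_rel M n `` {f}"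
    using assms(2) by (rule nablaE)
  have "AE t in M. False"
    using AE_in_essential_image[OF f(1)] empty f(2) by simp
  then show False using prob_space.AE_False[OF assms(1)] by blast
qed

text \<open>
  A class with essential image inside the image of an injective \<open>\<delta>\<close> comes from \<open>\<nabla>\<^sub>k\<close>; a preimage is
  obtained by applying a retraction \<open>r\<close> of \<open>\<delta>\<close>, hence depends continuously on \<open>a\<close>.
\<close>

lemma nabla_map_factor:
  assumes \<delta>: "\<delta> \<in> Delta k n" and r: "r \<in> Delta n k" "compose {..k} r \<delta> = restrict id {..k}"
    and a: "a \<in> nabla M n" "essential_image M a \<subseteq> \<delta> ` {..k}"
  shows "nabla_map M n \<delta> (nabla_map M k r a) = a"
proof -
  obtain f where f: "f \<in> measurable M (count_space {..n})" "a = ae_rel M n `` {f}"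
    using a(1) by (rule nablaE)
  have rd: "r (\<delta> i) = i" if "i \<le> k" for i
    using fun_cong[OF r(2), of i] that by simp
  have "AE t in M. f t \<in> essential_image M a"
    using AE_in_essential_image[OF f(1)] f(2) by simp
  then have "AE t in M. (\<delta> \<circ> (r \<circ> f)) t = f t"
  proof eventually_elim
    case (elim t)
    then obtain i where "i \<le> k" "f t = \<delta> i" using a(2) by blast
    then show ?case using rd by simp
  qed
  then show ?thesis
    using ae_class_eq_iff[OF measurable_Delta_comp[OF \<delta> measurable_Delta_comp[OF r(1) f(1)]] f(1)]
      nabla_map_class[OF r(1) f(1)] nabla_map_class[OF \<delta> measurable_Delta_comp[OF r(1) f(1)]] f(2)
    by simp
qed

lemma topspace_nabla_topology:
  assumes "prob_space M"
  shows "topspace (nabla_topology M n) = nabla M n"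
  unfolding nabla_topology_def by (rule Metric_space.topspace_mtopology[OF Metric_space_nabla[OF assms]])

lemma continuous_map_nabla_map:
  assumes M: "prob_space M" and \<sigma>: "\<sigma> \<in> Delta m n"
  shows "continuous_map (nabla_topology M m) (nabla_topology M n) (nabla_map M n \<sigma>)"
proof -
  interpret prob_space M by fact
  have le: "nabla_dist M (nabla_map M n \<sigma> a) (nabla_map M n \<sigma> b) \<le> nabla_dist M a b"
    if "a \<in> nabla M m" "b \<in> nabla M m" for a b
  proof -
    obtain f where f: "f \<in> measurable M (count_space {..m})" "a = ae_rel M m `` {f}"
      using \<open>a \<in> _\<close> by (rule nablaE)
    obtain g where g: "g \<in> measurable M (count_space {..m})" "b = ae_rel M m `` {g}"
      using \<open>b \<in> _\<close> by (rule nablaE)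
    have "measure M {t \<in> space M. (\<sigma> \<circ> f) t \<noteq> (\<sigma> \<circ> g) t} \<le> measure M {t \<in> space M. f t \<noteq> g t}"
      using sets_neq[OF f(1) g(1)] by (intro finite_measure_mono) auto
    then show ?thesis
      using \<sigma> f g by (simp add: nabla_map_class nabla_dist_class measurable_Delta_comp)
  qed
  show ?thesis
    unfolding nabla_topology_def
      Metric_space.metric_continuous_map[OF Metric_space_nabla[OF M] Metric_space_nabla[OF M]]
  proof (intro conjI ballI allI impI)
    show "nabla_map M n \<sigma> ` nabla M m \<subseteq> nabla M n"
      using nabla_map_closed[OF \<sigma>] by blast
    fix a and \<epsilon> :: real assume "a \<in> nabla M m" "0 < \<epsilon>"
    then show "\<exists>\<delta>>0. \<forall>x. x \<in> nabla M m \<and> nabla_dist M a x < \<delta> \<longrightarrow>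
        nabla_dist M (nabla_map M n \<sigma> a) (nabla_map M n \<sigma> x) < \<epsilon>"
      using le by (intro exI[of _ \<epsilon>]) (auto intro: le_less_trans)
  qed
qed

text \<open>If \<open>f\<close> takes the value \<open>i\<close> with probability \<open>r > 0\<close>, then every map at distance less than \<open>r\<close>
  from \<open>f\<close> takes the value \<open>i\<close> with positive probability.\<close>

lemma closedin_not_essential:
  assumes M: "prob_space M"
  shows "closedin (nabla_topology M n) {a \<in> nabla M n. i \<notin> essential_image M a}"
proof -
  interpret prob_space M by fact
  interpret N: Metric_space "nabla M n" "nabla_dist M" by (rule Metric_space_nabla[OF M])
  have "\<exists>r>0. N.mball a r \<subseteq> nabla M n \<inter> {a. i \<in> essential_image M a}"
    if a: "a \<in> nabla M n" "i \<in> essential_image M a" for a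
  proof -
    obtain f where f: "f \<in> measurable M (count_space {..n})" "a = ae_rel M n `` {f}"
      using a(1) by (rule nablaE)
    have meas: "{t \<in> space M. g t = i} \<in> sets M" if "g \<in> measurable M (count_space {..n})" for g
    proof -
      have "{t \<in> space M. g t = i} = g -` ({i} \<inter> {..n}) \<inter> space M"
        using measurable_le[OF that] by auto
      also have "\<dots> \<in> sets M" using that by (rule measurable_sets) simp
      finally show ?thesis .
    qed
    have null: "(AE t in M. g t \<noteq> i) \<longleftrightarrow> measure M {t \<in> space M. g t = i} = 0"
      if "g \<in> measurable M (count_space {..n})" for g
      using AE_iff_measurable[OF meas[OF that], of "\<lambda>t. g t \<noteq> i"] by (simp add: emeasure_eq_measure)
    define r where "r = measure M {t \<in> space M. f t = i}"
    have "r \<noteq> 0"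
      using a(2) null[OF f(1)] by (simp add: f(2) essential_image_class[OF f(1)] r_def)
    then have "r > 0" using measure_nonneg[of M] by (simp add: r_def zero_less_measure_iff)
    moreover have "i \<in> essential_image M b" if b: "b \<in> nabla M n" "nabla_dist M a b < r" for b
    proof (rule ccontr)
      assume ni: "i \<notin> essential_image M b"
      obtain g where g: "g \<in> measurable M (count_space {..n})" "b = ae_rel M n `` {g}"
        using b(1) by (rule nablaE)
      have "measure M {t \<in> space M. g t = i} = 0"
        using ni null[OF g(1)] by (simp add: g(2) essential_image_class[OF g(1)])
      moreover have "r \<le> measure M ({t \<in> space M. f t \<noteq> g t} \<union> {t \<in> space M. g t = i})"
        unfolding r_def using sets_neq[OF f(1) g(1)] meas[OF g(1)]
        by (intro finite_measure_mono) auto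
      moreover have "\<dots> \<le> measure M {t \<in> space M. f t \<noteq> g t} + measure M {t \<in> space M. g t = i}"
        using sets_neq[OF f(1) g(1)] meas[OF g(1)] by (rule measure_Un_le)
      ultimately have "r \<le> nabla_dist M a b"
        using nabla_dist_class[OF f(1) g(1)] f(2) g(2) by simp
      then show False using b(2) by simp
    qed
    ultimately show ?thesis by (intro exI[of _ r]) auto
  qed
  then have "openin N.mtopology (nabla M n \<inter> {a. i \<in> essential_image M a})"
    unfolding N.openin_mtopology by blast
  moreover have "nabla M n - {a \<in> nabla M n. i \<notin> essential_image M a} = 
      nabla M n \<inter> {a. i \<in> essential_image M a}"
    by blast
  ultimately show ?thesis
    unfolding nabla_topology_def by (simp add: closedin_def)
qed

lemma closedin_prod_discrete_topology:
  "closedin (prod_topology (discrete_topology D) Z) C \<longleftrightarrow>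
     C \<subseteq> D \<times> topspace Z \<and> (\<forall>x\<in>D. closedin Z {z. (x, z) \<in> C})"
proof (intro iffI conjI ballI)
  assume C: "closedin (prod_topology (discrete_topology D) Z) C"
  then show sub: "C \<subseteq> D \<times> topspace Z" using closedin_subset by fastforce
  fix x assume x: "x \<in> D"
  have "continuous_map Z (prod_topology (discrete_topology D) Z) (\<lambda>z. (x, z))"
    using x by (intro continuous_map_pairedI) auto
  from closedin_continuous_map_preimage[OF this C]
  have "closedin Z {z \<in> topspace Z. (x, z) \<in> C}" .
  moreover have "{z \<in> topspace Z. (x, z) \<in> C} = {z. (x, z) \<in> C}" using sub by blast
  ultimately show "closedin Z {z. (x, z) \<in> C}" by simp
next
  assume R: "C \<subseteq> D \<times> topspace Z \<and> (\<forall>x\<in>D. closedin Z {z. (x, z) \<in> C})"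
  have "openin (prod_topology (discrete_topology D) Z) ({x} \<times> (topspace Z - {z. (x, z) \<in> C}))"
    if "x \<in> D" for x
    using R that by (auto simp: openin_prod_Times_iff)
  then have "openin (prod_topology (discrete_topology D) Z)
      (\<Union>x\<in>D. {x} \<times> (topspace Z - {z. (x, z) \<in> C}))"
    by blast
  moreover have "(\<Union>x\<in>D. {x} \<times> (topspace Z - {z. (x, z) \<in> C})) = D \<times> topspace Z - C"
    by blast
  ultimately show "closedin (prod_topology (discrete_topology D) Z) C"
    using R by (auto simp: closedin_def)
qed

section \<open>Normal forms of points of \<open>L(F)\<close>\<close>

text \<open>The data from which the space \<open>L(F)\<close> is built.\<close>

locale realization = simplicial_set F act + prob_space M
  for F :: "nat \<Rightarrow> 'a set" and act :: "nat \<Rightarrow> nat \<Rightarrow> (nat \<Rightarrow> nat) \<Rightarrow> 'a \<Rightarrow> 'a"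
    and M :: "'w measure"
begin

lemma prob_space_M: "prob_space M"
  by (rule prob_space_axioms)

lemma simplicial_set_F: "simplicial_set F act"
  by (rule simplicial_set_axioms)

text \<open>
  Here \<open>x\<close> is the point \<open>(\<alpha>, \<nabla>(\<delta>)(a))\<close> with \<open>\<delta>\<close> injective and \<open>a\<close> of full essential image, so that \<open>\<delta>\<close>
  enumerates the essential image of the second component of \<open>x\<close>; the Eilenberg-Zilber
  decomposition \<open>\<alpha>\<delta> = \<gamma>\<sigma>\<close> then gives \<open>z = (\<gamma>, \<nabla>(\<sigma>)(a))\<close>.
\<close>

definition normal_form :: "('w, 'a) pre_point \<Rightarrow> ('w, 'a) pre_point \<Rightarrow> bool" where
  "normal_form x z \<longleftrightarrow> (\<exists>n \<alpha> k \<delta> a m \<sigma> \<gamma>.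
     x = (n, \<alpha>, nabla_map M n \<delta> a) \<and> z = (m, \<gamma>, nabla_map M m \<sigma> a) \<and>
     \<alpha> \<in> F n \<and> \<delta> \<in> Delta k n \<and> inj_on \<delta> {..k} \<and> a \<in> nabla M k \<and> essential_image M a = {..k} \<and>
     \<sigma> \<in> Delta k m \<and> \<sigma> ` {..k} = {..m} \<and> \<gamma> \<in> nondegenerate m \<and> act k n \<delta> \<alpha> = act k m \<sigma> \<gamma>)"

lemma normal_formI:
  assumes "\<alpha> \<in> F n" "\<delta> \<in> Delta k n" "inj_on \<delta> {..k}" "a \<in> nabla M k" "essential_image M a = {..k}"
    "\<sigma> \<in> Delta k m" "\<sigma> ` {..k} = {..m}" "\<gamma> \<in> nondegenerate m" "act k n \<delta> \<alpha> = act k m \<sigma> \<gamma>"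
  shows "normal_form (n, \<alpha>, nabla_map M n \<delta> a) (m, \<gamma>, nabla_map M m \<sigma> a)"
  unfolding normal_form_def using assms by blast

lemma normal_form_exists:
  assumes \<alpha>: "\<alpha> \<in> F n" and a: "a \<in> nabla M n"
  obtains m \<gamma> b where "normal_form (n, \<alpha>, a) (m, \<gamma>, b)" "m \<le> n" "essential_image M a \<noteq> {..n} \<Longrightarrow> m < n"
proof -
  obtain k \<delta> where \<delta>: "\<delta> \<in> Delta k n" "inj_on \<delta> {..k}" "\<delta> ` {..k} = essential_image M a"
    by (rule Delta_inj_of_subset[OF essential_image_subset[OF a] essential_image_nonempty[OF prob_space_M a]])
  obtain r where r: "r \<in> Delta n k" "compose {..k} r \<delta> = restrict id {..k}"
    by (rule Delta_retraction[OF \<delta>(1,2)])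
  define a' where "a' = nabla_map M k r a"
  have a': "a' \<in> nabla M k" "nabla_map M n \<delta> a' = a"
    using nabla_map_closed[OF r(1) a] nabla_map_factor[OF \<delta>(1) r a] \<delta>(3) by (auto simp: a'_def)
  have "essential_image M a' = r ` \<delta> ` {..k}"
    unfolding \<delta>(3) a'_def by (rule essential_image_map[OF r(1) a])
  also have "\<dots> = restrict id {..k} ` {..k}"
    unfolding r(2)[symmetric] image_compose_atMost ..
  finally have full: "essential_image M a' = {..k}" by simp
  obtain m \<sigma> \<gamma> where \<sigma>: "m \<le> k" "\<sigma> \<in> Delta k m" "\<sigma> ` {..k} = {..m}" "\<gamma> \<in> nondegenerate m"
    "act k n \<delta> \<alpha> = act k m \<sigma> \<gamma>"
    by (rule Eilenberg_Zilber_exists[OF act_closed[OF \<delta>(1) \<alpha>]])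
  have nf: "normal_form (n, \<alpha>, a) (m, \<gamma>, nabla_map M m \<sigma> a')"
    using normal_formI[OF \<alpha> \<delta>(1,2) a'(1) full \<sigma>(2-5)] by (simp add: a'(2))
  have kn: "k \<le> n" by (rule Delta_inj_le[OF \<delta>(1,2)])
  have "m < n" if "essential_image M a \<noteq> {..n}"
  proof -
    have "k \<noteq> n"
      using that \<delta> Delta_inj_endo by fastforce
    then show ?thesis using kn \<sigma>(1) by simp
  qed
  then show thesis using that[OF nf] kn \<sigma>(1) by simp
qed

lemma normal_form_target:
  assumes "normal_form x (m, \<gamma>, b)"
  shows "\<gamma> \<in> nondegenerate m" "b \<in> nabla M m" "essential_image M b = {..m}"
  using assms unfolding normal_form_def by (auto simp: essential_image_map nabla_map_closed)

lemma normal_form_self: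
  assumes "\<gamma> \<in> nondegenerate m" "b \<in> nabla M m" "essential_image M b = {..m}"
  shows "normal_form (m, \<gamma>, b) (m, \<gamma>, b)"
  using normal_formI[OF nondegenerate_subset[OF assms(1)] Delta_id _ assms(2,3) Delta_id _ assms(1) refl]
  by (simp add: nabla_map_id[OF assms(2)])

lemma normal_form_unique:
  assumes "normal_form x z" "normal_form x z'"
  shows "z = z'"
proof -
  obtain n \<alpha> k \<delta> a m \<sigma> \<gamma> where 1: "x = (n, \<alpha>, nabla_map M n \<delta> a)" "z = (m, \<gamma>, nabla_map M m \<sigma> a)"
     "\<alpha> \<in> F n" "\<delta> \<in> Delta k n" "inj_on \<delta> {..k}" "a \<in> nabla M k" "essential_image M a = {..k}"
     "\<sigma> \<in> Delta k m" "\<sigma> ` {..k} = {..m}" "\<gamma> \<in> nondegenerate m" "act k n \<delta> \<alpha> = act k m \<sigma> \<gamma>"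
    using assms(1) unfolding normal_form_def by (elim exE conjE)
  obtain n' \<alpha>' k' \<delta>' a' m' \<sigma>' \<gamma>' where 2: "x = (n', \<alpha>', nabla_map M n' \<delta>' a')"
     "z' = (m', \<gamma>', nabla_map M m' \<sigma>' a')"
     "\<alpha>' \<in> F n'" "\<delta>' \<in> Delta k' n'" "inj_on \<delta>' {..k'}" "a' \<in> nabla M k'" "essential_image M a' = {..k'}"
     "\<sigma>' \<in> Delta k' m'" "\<sigma>' ` {..k'} = {..m'}" "\<gamma>' \<in> nondegenerate m'" "act k' n' \<delta>' \<alpha>' = act k' m' \<sigma>' \<gamma>'"
    using assms(2) unfolding normal_form_def by (elim exE conjE)
  have x: "n' = n" "\<alpha>' = \<alpha>" "nabla_map M n \<delta> a = nabla_map M n \<delta>' a'"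
    using 1(1) 2(1) by auto
  have "\<delta> ` {..k} = \<delta>' ` {..k'}"
    using essential_image_map[OF 1(4,6)] essential_image_map[OF 2(4,6)] 1(7) 2(7) x by simp
  then have \<delta>: "k = k'" "\<delta> = \<delta>'"
    using Delta_inj_unique[OF 1(4,5) 2(4,5)] by auto
  obtain r where r: "r \<in> Delta n k" "compose {..k} r \<delta> = restrict id {..k}"
    by (rule Delta_retraction[OF 1(4,5)])
  have rd: "nabla_map M k r (nabla_map M n \<delta> b) = b" if "b \<in> nabla M k" for b
    using nabla_map_compose[OF 1(4) r(1) that] nabla_map_id[OF that] r(2) by simp
  have "a = nabla_map M k r (nabla_map M n \<delta> a)" by (rule rd[OF 1(6), symmetric])
  also have "\<dots> = nabla_map M k r (nabla_map M n \<delta>' a')" by (simp only: x(3))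
  also have "\<dots> = nabla_map M k r (nabla_map M n \<delta> a')" by (simp only: \<delta>(2))
  also have "\<dots> = a'" by (rule rd[OF 2(6)[folded \<delta>(1)]])
  finally have a: "a = a'" .
  have "act k m \<sigma> \<gamma> = act k m' \<sigma>' \<gamma>'" using 1(11) 2(11) x \<delta> by simp
  with Eilenberg_Zilber_unique[OF 1(8,9,10) 2(8,9,10)[folded \<delta>(1)]]
  have "m = m'" "\<sigma> = \<sigma>'" "\<gamma> = \<gamma>'" by simp_all
  then show ?thesis using 1(2) 2(2) a by simp
qed

text \<open>
  For \<open>x = (\<alpha>\<sigma>, a)\<close> and \<open>y = (\<alpha>, \<nabla>(\<sigma>)(a))\<close> with \<open>a = \<nabla>(\<delta>)(a')\<close>, factor \<open>\<sigma>\<delta> = \<delta>'\<tau>\<close> into a surjection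
  followed by an injection. The decomposition \<open>\<alpha>\<delta>' = \<gamma>'s'\<close> used for \<open>y\<close> yields the decomposition
  \<open>\<alpha>\<sigma>\<delta> = \<gamma>'(s'\<tau>)\<close> for \<open>x\<close>, and uniqueness identifies the two normal forms.
\<close>

lemma normal_form_L_gen:
  assumes gen: "L_gen M F act x y" and nf: "normal_form x z"
  shows "normal_form y z"
proof -
  obtain m n \<sigma> \<alpha> a where x: "\<sigma> \<in> Delta m n" "\<alpha> \<in> F n" "a \<in> nabla M m" "x = (m, act m n \<sigma> \<alpha>, a)"
     "y = (n, \<alpha>, nabla_map M n \<sigma> a)"
    using gen unfolding L_gen_def by (elim exE conjE)
  obtain n0 \<alpha>0 k \<delta> a' l s \<gamma> where nf': "x = (n0, \<alpha>0, nabla_map M n0 \<delta> a')" "z = (l, \<gamma>, nabla_map M l s a')"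
     "\<alpha>0 \<in> F n0" and \<delta>: "\<delta> \<in> Delta k n0" "inj_on \<delta> {..k}" and a': "a' \<in> nabla M k" "essential_image M a' = {..k}"
     and s: "s \<in> Delta k l" "s ` {..k} = {..l}" "\<gamma> \<in> nondegenerate l" "act k n0 \<delta> \<alpha>0 = act k l s \<gamma>"
    using nf unfolding normal_form_def by (elim exE conjE)
  have eq: "n0 = m" "\<alpha>0 = act m n \<sigma> \<alpha>" "a = nabla_map M m \<delta> a'"
    using nf'(1) x(4) by auto
  note \<delta> = \<delta>[unfolded eq(1)]
  obtain k' \<delta>' \<tau> where \<delta>': "\<delta>' \<in> Delta k' n" "inj_on \<delta>' {..k'}" and \<tau>: "\<tau> \<in> Delta k k'" "\<tau> ` {..k} = {..k'}"
    and fac: "compose {..k} \<sigma> \<delta> = compose {..k} \<delta>' \<tau>"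
    by (rule Delta_factor[OF Delta_compose[OF \<delta>(1) x(1)]])
  obtain l' s' \<gamma>' where s': "l' \<le> k'" "s' \<in> Delta k' l'" "s' ` {..k'} = {..l'}" "\<gamma>' \<in> nondegenerate l'"
    "act k' n \<delta>' \<alpha> = act k' l' s' \<gamma>'"
    by (rule Eilenberg_Zilber_exists[OF act_closed[OF \<delta>'(1) x(2)]])
  have "act k l s \<gamma> = act k m \<delta> (act m n \<sigma> \<alpha>)" using s(4) eq by simp
  also have "\<dots> = act k n (compose {..k} \<sigma> \<delta>) \<alpha>" using act_comp[OF \<delta>(1) x(1,2)] by simp
  also have "\<dots> = act k k' \<tau> (act k' n \<delta>' \<alpha>)" unfolding fac by (rule act_comp[OF \<tau>(1) \<delta>'(1) x(2)])
  also have "\<dots> = act k k' \<tau> (act k' l' s' \<gamma>')" using s'(5) by simp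
  also have "\<dots> = act k l' (compose {..k} s' \<tau>) \<gamma>'"
    using act_comp[OF \<tau>(1) s'(2) nondegenerate_subset[OF s'(4)]] by simp
  finally have eq2: "act k l s \<gamma> = act k l' (compose {..k} s' \<tau>) \<gamma>'" .
  have surj: "compose {..k} s' \<tau> ` {..k} = {..l'}"
    by (simp only: image_compose_atMost \<tau>(2) s'(3))
  note uniq = Eilenberg_Zilber_unique[OF s(1-3) Delta_compose[OF \<tau>(1) s'(2)] surj s'(4) eq2]
  have full: "essential_image M (nabla_map M k' \<tau> a') = {..k'}"
    using essential_image_map[OF \<tau>(1) a'(1)] a'(2) \<tau>(2) by simp
  have "normal_form (n, \<alpha>, nabla_map M n \<delta>' (nabla_map M k' \<tau> a')) (l', \<gamma>', nabla_map M l' s' (nabla_map M k' \<tau> a'))"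
    by (rule normal_formI[OF x(2) \<delta>' nabla_map_closed[OF \<tau>(1) a'(1)] full s'(2-5)])
  moreover have "nabla_map M n \<delta>' (nabla_map M k' \<tau> a') = nabla_map M n \<sigma> a"
    using nabla_map_compose[OF \<tau>(1) \<delta>'(1) a'(1)] nabla_map_compose[OF \<delta>(1) x(1) a'(1)] fac eq(3) by simp
  moreover have "nabla_map M l' s' (nabla_map M k' \<tau> a') = nabla_map M l s a'"
    using nabla_map_compose[OF \<tau>(1) s'(2) a'(1)] uniq by simp
  ultimately show ?thesis using uniq x(5) nf'(2) by simp
qed

lemma normal_form_cong:
  assumes "equivclp (L_gen M F act) x y" "normal_form x z"
  shows "normal_form y z"
  using assms
proof (induction rule: equivclp_induct)
  case (step y y')
  from step.hyps(2) show ?case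
  proof
    assume "L_gen M F act y y'"
    then show ?thesis using step.IH step.prems normal_form_L_gen by blast
  next
    assume gen: "L_gen M F act y' y"
    obtain n \<alpha> a where y': "y' = (n, \<alpha>, a)" "\<alpha> \<in> F n" "a \<in> nabla M n"
      using L_gen_in_topspace(1)[OF prob_space_M simplicial_set_F gen]
      by (auto simp: topspace_L_sum[OF prob_space_M])
    obtain m \<gamma> b where nf: "normal_form y' (m, \<gamma>, b)"
      using normal_form_exists[OF y'(2,3)] y'(1) by metis
    then have "normal_form y (m, \<gamma>, b)" by (rule normal_form_L_gen[OF gen])
    then show ?thesis using normal_form_unique step.IH step.prems nf by blast
  qed
qed

section \<open>The cell structure of \<open>L(F)\<close>\<close>

abbreviation L :: "('w, 'a) pre_point set topology" where
  "L \<equiv> L_space M F act"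

text \<open>The characteristic maps: the quotient map restricted to the points of level \<open>n\<close>.\<close>

definition char_map :: "nat \<Rightarrow> 'a \<times> ('w \<Rightarrow> nat) set \<Rightarrow> ('w, 'a) pre_point set" where
  "char_map n y = L_rel M F act `` {(n, y)}"

lemma topspace_sum: "topspace (L_sum M F) = (SIGMA n:UNIV. F n \<times> nabla M n)"
  by (rule topspace_L_sum[OF prob_space_M])

lemma topspace_L: "topspace L = topspace (L_sum M F) // L_rel M F act"
  unfolding L_space_def by (rule topspace_quotient_topology[OF equiv_L_rel])

lemma char_map_in: "\<lbrakk>\<alpha> \<in> F n; a \<in> nabla M n\<rbrakk> \<Longrightarrow> char_map n (\<alpha>, a) \<in> topspace L"
  unfolding topspace_L char_map_def by (rule quotientI) (simp add: topspace_sum)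

lemma char_map_eq_iff:
  assumes "\<alpha> \<in> F n" "a \<in> nabla M n" "\<beta> \<in> F m" "b \<in> nabla M m"
  shows "char_map n (\<alpha>, a) = char_map m (\<beta>, b) \<longleftrightarrow> equivclp (L_gen M F act) (n, \<alpha>, a) (m, \<beta>, b)"
proof -
  have top: "(n, \<alpha>, a) \<in> topspace (L_sum M F)" "(m, \<beta>, b) \<in> topspace (L_sum M F)"
    using assms by (auto simp: topspace_sum)
  show ?thesis
    unfolding char_map_def eq_equiv_class_iff[OF equiv_L_rel top] using top by (simp add: L_rel_def)
qed

lemma char_map_act:
  assumes "\<sigma> \<in> Delta m n" "\<alpha> \<in> F n" "a \<in> nabla M m"
  shows "char_map m (act m n \<sigma> \<alpha>, a) = char_map n (\<alpha>, nabla_map M n \<sigma> a)"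
  using assms
  by (subst char_map_eq_iff) (auto simp: L_gen_def intro!: act_closed nabla_map_closed r_into_equivclp)

lemma normal_form_char_map:
  assumes "normal_form (n, \<alpha>, a) (m, \<gamma>, b)"
  shows "char_map n (\<alpha>, a) = char_map m (\<gamma>, b)"
proof -
  obtain k \<delta> a' \<sigma> where "a = nabla_map M n \<delta> a'" "b = nabla_map M m \<sigma> a'"
     "\<alpha> \<in> F n" "\<delta> \<in> Delta k n" "a' \<in> nabla M k" "\<sigma> \<in> Delta k m" "\<gamma> \<in> nondegenerate m"
     "act k n \<delta> \<alpha> = act k m \<sigma> \<gamma>"
    using assms unfolding normal_form_def by blast
  then show ?thesis
    using char_map_act[of \<delta> k n \<alpha> a'] char_map_act[of \<sigma> k m \<gamma> a'] nondegenerate_subset by simp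
qed

lemma closedin_L_iff:
  "closedin L C \<longleftrightarrow> C \<subseteq> topspace L \<and>
     (\<forall>n. \<forall>\<alpha>\<in>F n. closedin (nabla_topology M n) {a \<in> nabla M n. char_map n (\<alpha>, a) \<in> C})"
proof (cases "C \<subseteq> topspace L")
  case True
  let ?P = "{x \<in> topspace (L_sum M F). L_rel M F act `` {x} \<in> C}"
  have slice: "{a. (\<alpha>, a) \<in> {y. (n, y) \<in> ?P}} = {a \<in> nabla M n. char_map n (\<alpha>, a) \<in> C}"
    if "\<alpha> \<in> F n" for n \<alpha>
    using that by (auto simp: topspace_sum char_map_def)
  have sub: "{y. (n, y) \<in> ?P} \<subseteq> F n \<times> topspace (nabla_topology M n)" for n
    by (auto simp: topspace_sum topspace_nabla_topology[OF prob_space_M])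
  have sub': "?P \<subseteq> Sigma UNIV (topspace \<circ> (\<lambda>n. prod_topology (discrete_topology (F n)) (nabla_topology M n)))"
    by (auto simp: topspace_sum topspace_nabla_topology[OF prob_space_M])
  have "closedin L C \<longleftrightarrow> closedin (L_sum M F) ?P"
    using quotient_map_L_space[of M F act] True unfolding quotient_map_closedin by blast
  also have "\<dots> \<longleftrightarrow>
      (\<forall>n. closedin (prod_topology (discrete_topology (F n)) (nabla_topology M n)) {y. (n, y) \<in> ?P})"
    unfolding L_sum_def[of M F] closedin_sum_topology unfolding L_sum_def[symmetric] using sub' by simp
  also have "\<dots> \<longleftrightarrow> (\<forall>n. \<forall>\<alpha>\<in>F n. closedin (nabla_topology M n) {a \<in> nabla M n. char_map n (\<alpha>, a) \<in> C})"
    unfolding closedin_prod_discrete_topology using sub slice by simp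
  finally show ?thesis using True by simp
qed (auto dest: closedin_subset)

text \<open>
  The disjoint union of one copy of \<open>\<nabla>\<^sub>n\<close> for each nondegenerate element of \<open>F n\<close>.
\<close>

definition cells :: "nat \<Rightarrow> ('a \<times> ('w \<Rightarrow> nat) set) topology" where
  "cells n = prod_topology (discrete_topology (nondegenerate n)) (nabla_topology M n)"

text \<open>The part along which these copies are attached: the classes that miss some value.\<close>

definition cells_boundary :: "nat \<Rightarrow> ('a \<times> ('w \<Rightarrow> nat) set) set" where
  "cells_boundary n = {(\<alpha>, a). \<alpha> \<in> nondegenerate n \<and> a \<in> nabla M n \<and> essential_image M a \<noteq> {..n}}"

lemma topspace_cells: "topspace (cells n) = nondegenerate n \<times> nabla M n"
  by (simp add: cells_def topspace_nabla_topology[OF prob_space_M])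

lemma closedin_cells_iff:
  "closedin (cells n) {y \<in> topspace (cells n). char_map n y \<in> C} \<longleftrightarrow>
     (\<forall>\<alpha>\<in>nondegenerate n. closedin (nabla_topology M n) {a \<in> nabla M n. char_map n (\<alpha>, a) \<in> C})"
  unfolding cells_def closedin_prod_discrete_topology
  by (auto simp: topspace_nabla_topology[OF prob_space_M])

text \<open>
  Closedness along the nondegenerate elements of dimension at most \<open>n\<close> implies closedness along all
  elements of dimension \<open>n\<close>, by the Eilenberg-Zilber decomposition.
\<close>

lemma closedin_char_map_preimage:
  assumes C: "\<And>m. m \<le> n \<Longrightarrow> closedin (cells m) {y \<in> topspace (cells m). char_map m y \<in> C}"
    and \<alpha>: "\<alpha> \<in> F n"
  shows "closedin (nabla_topology M n) {a \<in> nabla M n. char_map n (\<alpha>, a) \<in> C}"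
proof -
  obtain m \<sigma> \<gamma> where \<sigma>: "m \<le> n" "\<sigma> \<in> Delta n m" "\<sigma> ` {..n} = {..m}" "\<gamma> \<in> nondegenerate m"
    "\<alpha> = act n m \<sigma> \<gamma>"
    by (rule Eilenberg_Zilber_exists[OF \<alpha>])
  have "closedin (nabla_topology M m) {b \<in> nabla M m. char_map m (\<gamma>, b) \<in> C}"
    using C[OF \<sigma>(1)] \<sigma>(4) unfolding closedin_cells_iff by blast
  from closedin_continuous_map_preimage[OF continuous_map_nabla_map[OF prob_space_M \<sigma>(2)] this]
  have "closedin (nabla_topology M n)
      {a \<in> nabla M n. nabla_map M m \<sigma> a \<in> {b \<in> nabla M m. char_map m (\<gamma>, b) \<in> C}}"
    by (simp add: topspace_nabla_topology[OF prob_space_M])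
  also have "{a \<in> nabla M n. nabla_map M m \<sigma> a \<in> {b \<in> nabla M m. char_map m (\<gamma>, b) \<in> C}} =
      {a \<in> nabla M n. char_map n (\<alpha>, a) \<in> C}"
    using char_map_act[OF \<sigma>(2) nondegenerate_subset[OF \<sigma>(4)]] nabla_map_closed[OF \<sigma>(2)] \<sigma>(5) by auto
  finally show ?thesis .
qed

text \<open>
  The attaching maps are continuous for the weak topology of the lower skeleton. The
  boundary of \<open>\<nabla>\<^sub>n\<close> is the union of the finitely many closed faces of classes that miss some value \<open>i\<close>.
  On such a face the characteristic map of \<open>\<alpha>\<close> is that of \<open>\<alpha>\<delta>\<close> composed with a retraction
  onto \<open>\<nabla>\<^sub>k\<close>, \<open>k < n\<close>, where \<open>\<delta>\<close> enumerates the values other than \<open>i\<close>.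
\<close>

lemma closedin_boundary_preimage:
  assumes C: "\<And>m. m < n \<Longrightarrow> closedin (cells m) {y \<in> topspace (cells m). char_map m y \<in> C}"
    and \<alpha>: "\<alpha> \<in> F n"
  shows "closedin (nabla_topology M n)
    {a \<in> nabla M n. essential_image M a \<noteq> {..n} \<and> char_map n (\<alpha>, a) \<in> C}"
proof -
  have face: "closedin (nabla_topology M n)
      {a \<in> nabla M n. i \<notin> essential_image M a \<and> char_map n (\<alpha>, a) \<in> C}" if i: "i \<le> n" for i
  proof (cases "{..n} - {i} = {}")
    \<comment> \<open>This happens only for \<open>n = 0\<close>, where the boundary is empty.\<close>
    case True
    have "i \<in> essential_image M a" if "a \<in> nabla M n" for a
      using essential_image_subset[OF that] essential_image_nonempty[OF prob_space_M that] True by blast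
    then have "{a \<in> nabla M n. i \<notin> essential_image M a \<and> char_map n (\<alpha>, a) \<in> C} = {}" by auto
    then show ?thesis by (simp only: closedin_empty)
  next
    case False
    have sub: "{..n} - {i} \<subseteq> {..n}" by blast
    obtain k \<delta> where \<delta>: "\<delta> \<in> Delta k n" "inj_on \<delta> {..k}" "\<delta> ` {..k} = {..n} - {i}"
      by (rule Delta_inj_of_subset[OF sub False])
    have "k \<noteq> n" using Delta_inj_endo[of \<delta> k] \<delta> i by fastforce
    then have kn: "k < n" using Delta_inj_le[OF \<delta>(1,2)] by simp
    obtain r where r: "r \<in> Delta n k" "compose {..k} r \<delta> = restrict id {..k}"
      by (rule Delta_retraction[OF \<delta>(1,2)])
    have "closedin (nabla_topology M k) {b \<in> nabla M k. char_map k (act k n \<delta> \<alpha>, b) \<in> C}"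
      using C kn by (intro closedin_char_map_preimage act_closed[OF \<delta>(1) \<alpha>]) simp
    from closedin_continuous_map_preimage[OF continuous_map_nabla_map[OF prob_space_M r(1)] this]
    have "closedin (nabla_topology M n)
        {a \<in> nabla M n. nabla_map M k r a \<in> {b \<in> nabla M k. char_map k (act k n \<delta> \<alpha>, b) \<in> C}}"
      by (simp add: topspace_nabla_topology[OF prob_space_M])
    from closedin_Int[OF this closedin_not_essential[OF prob_space_M, of n i]]
    show ?thesis
    proof (rule back_subst[of "closedin (nabla_topology M n)"])
      have "char_map k (act k n \<delta> \<alpha>, nabla_map M k r a) = char_map n (\<alpha>, a)"
        if a: "a \<in> nabla M n" "i \<notin> essential_image M a" for a
      proof -
        have "essential_image M a \<subseteq> \<delta> ` {..k}"
          using essential_image_subset[OF a(1)] a(2) \<delta>(3) by blast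
        then have "nabla_map M n \<delta> (nabla_map M k r a) = a"
          by (rule nabla_map_factor[OF \<delta>(1) r a(1)])
        then show ?thesis
          using char_map_act[OF \<delta>(1) \<alpha> nabla_map_closed[OF r(1) a(1)]] by simp
      qed
      then show "{a \<in> nabla M n. nabla_map M k r a \<in> {b \<in> nabla M k. char_map k (act k n \<delta> \<alpha>, b) \<in> C}} \<inter>
          {a \<in> nabla M n. i \<notin> essential_image M a} =
          {a \<in> nabla M n. i \<notin> essential_image M a \<and> char_map n (\<alpha>, a) \<in> C}"
        using nabla_map_closed[OF r(1)] by auto
    qed
  qed
  have "closedin (nabla_topology M n)
      (\<Union>i\<in>{..n}. {a \<in> nabla M n. i \<notin> essential_image M a \<and> char_map n (\<alpha>, a) \<in> C})"
    using face by (intro closedin_Union) auto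
  also have "(\<Union>i\<in>{..n}. {a \<in> nabla M n. i \<notin> essential_image M a \<and> char_map n (\<alpha>, a) \<in> C}) =
      {a \<in> nabla M n. essential_image M a \<noteq> {..n} \<and> char_map n (\<alpha>, a) \<in> C}"
    using essential_image_subset by blast
  finally show ?thesis .
qed

lemma cell_filtration_L: "cell_filtration L cells cells_boundary char_map"
proof
  show "metrizable_space (cells n)" for n
    using Metric_space.metrizable_space_mtopology[OF Metric_space_nabla[OF prob_space_M]]
    by (simp add: cells_def nabla_topology_def metrizable_space_prod_topology)
  show "closedin (cells n) (cells_boundary n)" for n
  proof -
    have "closedin (nabla_topology M n) (\<Union>i\<in>{..n}. {a \<in> nabla M n. i \<notin> essential_image M a})"
      using closedin_not_essential[OF prob_space_M] by (intro closedin_Union) auto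
    also have "(\<Union>i\<in>{..n}. {a \<in> nabla M n. i \<notin> essential_image M a}) =
        {a \<in> nabla M n. essential_image M a \<noteq> {..n}}"
      using essential_image_subset by blast
    finally show ?thesis
      by (auto simp: cells_def closedin_prod_discrete_topology cells_boundary_def
          topspace_nabla_topology[OF prob_space_M])
  qed
  show "char_map n y \<in> topspace L" if "y \<in> topspace (cells n)" for n y
    using that char_map_in nondegenerate_subset by (auto simp: topspace_cells)
  have nf_cell: "\<exists>z\<in>topspace (cells m) - cells_boundary m. char_map n (\<alpha>, a) = char_map m z"
    if "normal_form (n, \<alpha>, a) (m, \<gamma>, b)" for n \<alpha> a m \<gamma> b
    using normal_form_target[OF that] normal_form_char_map[OF that]
    by (intro bexI[of _ "(\<gamma>, b)"]) (auto simp: topspace_cells cells_boundary_def)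
  show "\<exists>m<n. \<exists>z\<in>topspace (cells m) - cells_boundary m. char_map n y = char_map m z"
    if y: "y \<in> cells_boundary n" for n y
  proof -
    obtain \<alpha> a where a: "y = (\<alpha>, a)" "\<alpha> \<in> nondegenerate n" "a \<in> nabla M n" "essential_image M a \<noteq> {..n}"
      using y by (auto simp: cells_boundary_def)
    obtain m \<gamma> b where nf: "normal_form (n, \<alpha>, a) (m, \<gamma>, b)" "m < n"
      using normal_form_exists[OF nondegenerate_subset[OF a(2)] a(3)] a(4) by metis
    then show ?thesis using nf_cell[OF nf(1)] a(1) by blast
  qed
  show "n = m \<and> y = z"
    if "y \<in> topspace (cells n) - cells_boundary n" "z \<in> topspace (cells m) - cells_boundary m"
      "char_map n y = char_map m z" for n m y z
  proof -
    obtain \<alpha> a where a': "y = (\<alpha>, a)" by (cases y)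
    have a: "y = (\<alpha>, a)" "\<alpha> \<in> nondegenerate n" "a \<in> nabla M n" "essential_image M a = {..n}"
      using that(1) a' by (auto simp: topspace_cells cells_boundary_def)
    obtain \<beta> b where b': "z = (\<beta>, b)" by (cases z)
    have b: "z = (\<beta>, b)" "\<beta> \<in> nondegenerate m" "b \<in> nabla M m" "essential_image M b = {..m}"
      using that(2) b' by (auto simp: topspace_cells cells_boundary_def)
    have "equivclp (L_gen M F act) (n, \<alpha>, a) (m, \<beta>, b)"
      using char_map_eq_iff that(3) a b nondegenerate_subset by simp
    then have "normal_form (m, \<beta>, b) (n, \<alpha>, a)"
      by (rule normal_form_cong[OF _ normal_form_self[OF a(2-4)]])
    from normal_form_unique[OF this normal_form_self[OF b(2-4)]] show ?thesis using a(1) b(1) by simp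
  qed
  show "\<exists>n. \<exists>y\<in>topspace (cells n) - cells_boundary n. x = char_map n y" if x: "x \<in> topspace L" for x
  proof -
    obtain n \<alpha> a where a: "\<alpha> \<in> F n" "a \<in> nabla M n" "x = char_map n (\<alpha>, a)"
      using x unfolding topspace_L char_map_def by (auto simp: topspace_sum elim!: quotientE)
    obtain m \<gamma> b where "normal_form (n, \<alpha>, a) (m, \<gamma>, b)"
      using normal_form_exists[OF a(1,2)] by metis
    then show ?thesis using nf_cell a(3) by blast
  qed
  show "closedin L C \<longleftrightarrow> C \<subseteq> topspace L \<and>
      (\<forall>n. closedin (cells n) {y \<in> topspace (cells n). char_map n y \<in> C})" for C
  proof (intro iffI conjI allI)
    assume "closedin L C"
    then show "C \<subseteq> topspace L" "closedin (cells n) {y \<in> topspace (cells n). char_map n y \<in> C}" for n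
      using nondegenerate_subset unfolding closedin_cells_iff by (auto simp: closedin_L_iff)
  next
    assume "C \<subseteq> topspace L \<and> (\<forall>n. closedin (cells n) {y \<in> topspace (cells n). char_map n y \<in> C})"
    then show "closedin L C"
      using closedin_char_map_preimage unfolding closedin_L_iff by blast
  qed
  show "closedin (cells n) {y \<in> cells_boundary n. char_map n y \<in> C}"
    if "C \<subseteq> topspace L" "\<And>m. m < n \<Longrightarrow> closedin (cells m) {y \<in> topspace (cells m). char_map m y \<in> C}"
    for C n
  proof -
    have "{a. (\<alpha>, a) \<in> {y \<in> cells_boundary n. char_map n y \<in> C}} =
        {a \<in> nabla M n. essential_image M a \<noteq> {..n} \<and> char_map n (\<alpha>, a) \<in> C}"
      if "\<alpha> \<in> nondegenerate n" for \<alpha>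
      using that by (auto simp: cells_boundary_def)
    moreover have "{y \<in> cells_boundary n. char_map n y \<in> C} \<subseteq> nondegenerate n \<times> topspace (nabla_topology M n)"
      by (auto simp: cells_boundary_def topspace_nabla_topology[OF prob_space_M])
    ultimately show ?thesis
      using closedin_boundary_preimage[OF that(2)] nondegenerate_subset
      unfolding cells_def closedin_prod_discrete_topology by simp
  qed
qed

end

theorem proposition3p7:
  fixes M :: "'w measure"
    and F :: "nat \<Rightarrow> 'a set"
    and act :: "nat \<Rightarrow> nat \<Rightarrow> (nat \<Rightarrow> nat) \<Rightarrow> 'a \<Rightarrow> 'a"
  assumes "prob_space M"
    and "complete_measure M"
    and "atomless M"
    and "simplicial_set F act"
  shows "paracompact_space (L_space M F act) \<and>
         perfectly_normal_space (L_space M F act) \<and>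
         k_space (L_space M F act)"
proof -
  interpret realization F act M
    using assms(1,4) by (rule realization.intro[rotated])
  interpret cell_filtration L cells cells_boundary char_map
    by (rule cell_filtration_L)
  show ?thesis
    using paracompact perfectly_normal k_space by blast
qed

end
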